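(* Let $f:\mathbb R^{n}\times \mathbb R^{m}\to \mathbb R$ and suppose: (1) there are $\kappa\ge 0$ and $\sigma>0$ such that $(x,y)\mapsto f(x,y) + \frac{\kappa}{2} \|x\|^2-\frac{\sigma}{2}\|y\|^2$ is convex on $\mathbb R^{n}\times\mathbb R^m$; (2) for each $x\in \mathbb R^{n}$ there is a unique $\gamma(x)\in\mathbb R^m$ such that $\inf_{y\in\mathbb R^m} f(x,y) = f(x,\gamma(x))$. Then the function $\gamma:\mathbb R^n\to\mathbb R^m$ is differentiable almost everywhere (with respect to Lebesgue measure). *)

theory Defs
  imports "HOL-Analysis.Analysis"
begin

end

theory Submission
  imports Defs
begin

text \<open>
  The function \<open>\<phi> x = f x (\<gamma> x) + \<kappa> / 2 * (norm x)\<^sup>2\<close> is convex, and strong convexity in \<open>y\<close> upgrades the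
  monotonicity of its subgradients to
  \<open>\<sigma> / 2 * (norm (\<gamma> x - \<gamma> y))\<^sup>2 \<le> (p - q) \<bullet> (x - y)\<close>. Hence, as functions of \<open>z = x + p\<close> where
  \<open>p\<close> is a subgradient at \<open>x\<close>, both \<open>x = P z\<close> and \<open>\<gamma> x = G z\<close> are Lipschitz. By Rademacher's theorem
  \<open>P\<close> and \<open>G\<close> are differentiable off a null set, whose image under \<open>P\<close> is null; the critical values of
  \<open>P\<close> are null as well. At any other \<open>x\<close> the subgradient is unique, so \<open>x \<mapsto> z\<close> is continuous there and
  therefore differentiable as an inverse of \<open>P\<close>, and \<open>\<gamma>\<close> is its composition with \<open>G\<close>.

  Rademacher's theorem is reduced to Lipschitz functions of one real variable: directional derivatives exist
  almost everywhere, their integrals over boxes are additive in the direction, and countably many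
  directions suffice by the Lipschitz bound.
\<close>

section \<open>Rademacher's theorem\<close>

lemma lipschitz_real_imp_AE_differentiable:
  fixes g :: "real \<Rightarrow> real"
  assumes lip: "L-lipschitz_on UNIV g"
  shows "AE t in lborel. g differentiable at t"
proof -
  have L: "0 \<le> L"
    using lip by (rule lipschitz_on_nonneg)
  \<comment> \<open>The slope \<open>L + 1\<close> makes \<open>F\<close> increasing and expanding
    by a factor of at least 1, so that its inverse is 1-Lipschitz, while \<open>F\<close> itself
    stays Lipschitz.\<close>
  define F where "F t = g t + (L + 1) * t" for t
  have F: "t - s \<le> F t - F s" "F t - F s \<le> (2 * L + 1) * (t - s)" if "s \<le> t" for s t
    using lipschitz_on_normD[OF lip, of t s] that by (auto simp: F_def algebra_simps)
  have lipF: "(2 * L + 1)-lipschitz_on UNIV F"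
  proof (rule lipschitz_onI)
    show "dist (F s) (F t) \<le> (2 * L + 1) * dist s t" for s t
      using F[of s t] F[of t s] by (cases "s \<le> t") (auto simp: dist_real_def abs_if)
  qed (use L in auto)
  have F_less_iff: "F s \<le> F t \<longleftrightarrow> s \<le> t" for s t
    using F(1)[of s t] F(1)[of t s] by linarith
  have F_surj: "\<exists>t. F t = y" for y
  proof -
    have "F (- \<bar>y - F 0\<bar>) \<le> y" "y \<le> F \<bar>y - F 0\<bar>"
      using F(1)[of "- \<bar>y - F 0\<bar>" 0] F(1)[of 0 "\<bar>y - F 0\<bar>"] by linarith+
    moreover have "continuous_on {- \<bar>y - F 0\<bar>..\<bar>y - F 0\<bar>} F"
      using lipschitz_on_continuous_on[OF lipF] continuous_on_subset by blast
    ultimately show ?thesis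
      using IVT'[of F "- \<bar>y - F 0\<bar>" y "\<bar>y - F 0\<bar>"] by force
  qed
  then obtain K where K: "\<And>y. F (K y) = y"
    by metis
  have K_le: "a \<le> K y \<longleftrightarrow> F a \<le> y" "K y \<le> a \<longleftrightarrow> y \<le> F a" for a y
    using F_less_iff[of a "K y"] F_less_iff[of "K y" a] by (simp_all add: K)
  have "1-lipschitz_on UNIV K"
  proof (rule lipschitz_onI)
    show "dist (K y) (K z) \<le> 1 * dist y z" for y z
      using F(1)[of "K y" "K z"] F(1)[of "K z" "K y"]
      by (cases "K y \<le> K z") (auto simp: dist_real_def K abs_if)
  qed auto
  then have [measurable]: "K \<in> borel_measurable borel"
    by (intro borel_measurable_continuous_onI lipschitz_on_continuous_on)
  \<comment> \<open>The inverse of the expanding Lipschitz map F pushes Lebesgue measure forward to a measure whose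
    distribution function is F. It is absolutely continuous because F maps null sets to null sets,
    and F is differentiable at every Lebesgue point of its density.\<close>
  define \<mu> where "\<mu> = distr lborel borel K"
  have \<mu>_Icc: "emeasure \<mu> {a..b} = ennreal (F b - F a)" if "a \<le> b" for a b
  proof -
    have "K -` {a..b} = {F a..F b}"
      by (auto simp: K_le)
    then show ?thesis
      using that by (simp add: \<mu>_def emeasure_distr F_less_iff)
  qed
  have "absolutely_continuous lborel \<mu>"
    unfolding absolutely_continuous_def
  proof
    fix A :: "real set" assume A: "A \<in> null_sets lborel"
    then have [measurable]: "A \<in> sets borel" by auto
    have "negligible A"
      using A by (simp add: negligible_iff_null_sets null_sets_completionI)
    then have "negligible (F ` A)"
      using lipschitz_on_normD[OF lipF]
      by (intro negligible_locally_Lipschitz_image) (auto intro!: exI[of _ UNIV])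
    moreover have "K -` A = F ` A"
    proof -
      have "K (F t) = t" for t
        using K_le[of t "F t"] K_le[of "F t" t] by (simp add: order_antisym)
      then show ?thesis
        by (auto simp: image_iff) (metis K)
    qed
    moreover have "K -` A \<in> sets borel"
      using measurable_sets[of K borel borel A] by simp
    ultimately have "K -` A \<in> null_sets lborel"
      by (simp add: negligible_iff_null_sets null_sets_completion_iff)
    then show "A \<in> null_sets \<mu>"
      by (auto simp: \<mu>_def null_sets_def emeasure_distr)
  qed
  then obtain h :: "real \<Rightarrow> ennreal"
    where h[measurable]: "h \<in> borel_measurable borel" and dens: "density lborel h = \<mu>"
    using sigma_finite_measure.Radon_Nikodym[OF sigma_finite_lborel, of \<mu>] by (auto simp: \<mu>_def)
  have h_Icc: "(\<integral>\<^sup>+t. h t * indicator {a..b} t \<partial>lborel) = ennreal (F b - F a)" if "a \<le> b" for a b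
    using \<mu>_Icc[OF that] by (simp add: dens[symmetric] emeasure_density)
  \<comment> \<open>The density has finite integral over each interval \<open>{- n..n}\<close>. It
    is therefore finite almost everywhere and may be replaced by the real-valued
    \<open>p\<close>.\<close>
  have fin: "AE t in lborel. h t \<noteq> \<infinity>"
  proof -
    have "AE t in lborel. h t * indicator {- real n..real n} t \<noteq> \<infinity>" for n
      by (rule nn_integral_PInf_AE) (auto simp: h_Icc)
    then have "AE t in lborel. \<forall>n. h t * indicator {- real n..real n} t \<noteq> \<infinity>"
      by (simp add: AE_all_countable)
    then show ?thesis
    proof (rule AE_mp, intro AE_I2 impI)
      fix t assume *: "\<forall>n. h t * indicator {- real n..real n} t \<noteq> \<infinity>"
      obtain n where "\<bar>t\<bar> \<le> real n"
        using real_arch_simple by blast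
      then have "t \<in> {- real n..real n}" by auto
      then show "h t \<noteq> \<infinity>"
        using *[rule_format, of n] by simp
    qed
  qed
  define p where "p t = enn2real (h t)" for t
  have p_int: "(p has_integral (F b - F a)) {a..b}" if "a \<le> b" for a b
  proof -
    have "(\<integral>\<^sup>+t. ennreal (indicator {a..b} t * p t) \<partial>lborel) = (\<integral>\<^sup>+t. h t * indicator {a..b} t \<partial>lborel)"
      using fin by (intro nn_integral_cong_AE) (auto simp: p_def indicator_def less_top)
    also have "\<dots> = ennreal (F b - F a)"
      using that by (rule h_Icc)
    finally have "((\<lambda>t. indicator {a..b} t * p t) has_integral (F b - F a)) UNIV"
      using that by (intro nn_integral_has_integral) (auto simp: p_def F_less_iff)
    then have "((\<lambda>t. if t \<in> {a..b} then p t else 0) has_integral (F b - F a)) UNIV"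
      by (rule has_integral_eq_rhs[OF has_integral_eq, rotated]) auto
    then show ?thesis
      by (simp only: has_integral_restrict_UNIV)
  qed
  have "p integrable_on cbox a b" for a b
    using p_int[of a b] by (cases "a \<le> b") auto
  then obtain N where N: "negligible N"
    and right: "\<And>t e. t \<notin> N \<Longrightarrow> 0 < e \<Longrightarrow> \<exists>d>0. \<forall>k. 0 < k \<and> k < d \<longrightarrow>
        norm (integral (cbox t (t + k *\<^sub>R One)) p /\<^sub>R k ^ DIM(real) - p t) < e"
    by (rule integrable_ccontinuous_explicit) blast
  \<comment> \<open>The Lebesgue points in the library are one-sided; the reflected density gives the other side.\<close>
  have q_int: "((\<lambda>t. p (- t)) has_integral (F (- a) - F (- b))) {a..b}" if "a \<le> b" for a b
    using p_int[of "- b" "- a"] that has_integral_reflect_real[of p "F (- a) - F (- b)" "- a" "- b"] by auto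
  have "(\<lambda>t. p (- t)) integrable_on cbox a b" for a b
    using q_int[of a b] by (cases "a \<le> b") auto
  then obtain N' where N': "negligible N'"
    and left: "\<And>t e. t \<notin> N' \<Longrightarrow> 0 < e \<Longrightarrow> \<exists>d>0. \<forall>k. 0 < k \<and> k < d \<longrightarrow>
        norm (integral (cbox t (t + k *\<^sub>R One)) (\<lambda>t. p (- t)) /\<^sub>R k ^ DIM(real) - p (- t)) < e"
    by (rule integrable_ccontinuous_explicit) blast
  have diff: "g differentiable at t" if t: "t \<notin> N" "- t \<notin> N'" for t
  proof -
    have "((\<lambda>k. (F (t + k) - F t) / k) \<longlongrightarrow> p t) (at 0)"
    proof (rule LIM_I)
      fix e :: real assume e: "0 < e"
      obtain d1 where d1: "d1 > 0"
        "\<And>k. 0 < k \<Longrightarrow> k < d1 \<Longrightarrow> \<bar>integral {t..t + k} p / k - p t\<bar> < e"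
        using right[OF t(1) e] by (auto simp: divide_inverse_commute)
      obtain d2 where d2: "d2 > 0"
        "\<And>k. 0 < k \<Longrightarrow> k < d2 \<Longrightarrow> \<bar>integral {- t..- t + k} (\<lambda>t. p (- t)) / k - p t\<bar> < e"
        using left[OF t(2) e] by (auto simp: divide_inverse_commute)
      have "\<bar>(F (t + k) - F t) / k - p t\<bar> < e" if k: "k \<noteq> 0" "\<bar>k\<bar> < min d1 d2" for k
      proof (cases "0 < k")
        case True
        then have "integral {t..t + k} p = F (t + k) - F t"
          using p_int[of t "t + k"] by (intro integral_unique) auto
        then show ?thesis
          using d1(2)[of k] True k by simp
      next
        case False
        then have "integral {- t..- t + - k} (\<lambda>t. p (- t)) = F t - F (t + k)"
          using q_int[of "- t" "- t + - k"] by (intro integral_unique) (auto simp: add.commute)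
        moreover have "(F t - F (t + k)) / - k = (F (t + k) - F t) / k"
          by (simp add: divide_simps)
        ultimately show ?thesis
          using d2(2)[of "- k"] False k by simp
      qed
      then show "\<exists>s>0. \<forall>k. k \<noteq> 0 \<and> norm (k - 0) < s \<longrightarrow> norm ((F (t + k) - F t) / k - p t) < e"
        using d1(1) d2(1) by (intro exI[of _ "min d1 d2"]) auto
    qed
    then have "(F has_real_derivative p t) (at t)"
      by (simp add: DERIV_def)
    then have "((\<lambda>t. F t - (L + 1) * t) has_real_derivative p t - (L + 1)) (at t)"
      by (auto intro!: derivative_eq_intros)
    moreover have "(\<lambda>t. F t - (L + 1) * t) = g"
      by (auto simp: F_def)
    ultimately show ?thesis
      using real_differentiable_def by metis
  qed
  have "negligible (N \<union> uminus ` N')"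
    using N N' by (intro negligible_Un negligible_differentiable_image_negligible)
      (auto intro!: derivative_intros)
  then have "AE t in lebesgue. t \<notin> N \<union> uminus ` N'"
    unfolding negligible_iff_null_sets by (rule AE_not_in)
  then have "AE t in lebesgue. g differentiable at t"
    by (rule AE_mp) (auto intro!: AE_I2 diff simp: image_iff)
  then show ?thesis
    by (simp add: AE_completion_iff)
qed

section \<open>Almost everywhere existence of directional derivatives\<close>

lemma lipschitz_on_line:
  assumes "L-lipschitz_on UNIV f"
  shows "(L * norm v)-lipschitz_on UNIV (\<lambda>t. f (x + t *\<^sub>R v))"
proof (rule lipschitz_onI)
  show "dist (f (x + s *\<^sub>R v)) (f (x + t *\<^sub>R v)) \<le> L * norm v * dist s t" for s t
    using lipschitz_onD[OF assms, of "x + s *\<^sub>R v" "x + t *\<^sub>R v"]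
    by (simp add: dist_norm mult.assoc mult.commute[of "norm v"] flip: scaleR_diff_left)
qed (use lipschitz_on_nonneg[OF assms] in simp)

text \<open>Cauchy criterion for the difference quotients. It mentions no value of the derivative
  and quantifies the tolerance and the radius over natural numbers, which makes the set of points of
  differentiability accessible to countable set operations.\<close>

lemma differentiable_at_0_iff_Cauchy:
  fixes g :: "real \<Rightarrow> real"
  shows "g differentiable at 0 \<longleftrightarrow>
    (\<forall>k::nat. \<exists>j::nat. \<forall>s\<in>ball 0 (1 / Suc j) - {0}. \<forall>t\<in>ball 0 (1 / Suc j) - {0}.
      \<bar>(g s - g 0) / s - (g t - g 0) / t\<bar> \<le> 1 / Suc k)" (is "?D \<longleftrightarrow> ?C")
proof
  assume ?D
  then obtain d where "(g has_real_derivative d) (at 0)"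
    using real_differentiable_def by blast
  then have lim: "((\<lambda>t. (g t - g 0) / t) \<longlongrightarrow> d) (at 0)"
    by (simp add: DERIV_def)
  show ?C
  proof
    fix k :: nat
    define e where "e = 1 / (2 * real (Suc k))"
    have e: "0 < e" "1 / Suc k = 2 * e"
      by (simp_all add: e_def divide_simps)
    from LIM_D[OF lim e(1)] obtain r where r: "r > 0"
      "\<And>t. t \<noteq> 0 \<Longrightarrow> \<bar>t\<bar> < r \<Longrightarrow> \<bar>(g t - g 0) / t - d\<bar> < e"
      by auto
    obtain j where j: "1 / Suc j < r"
      using nat_approx_posE[OF r(1)] by auto
    have "\<bar>(g s - g 0) / s - (g t - g 0) / t\<bar> \<le> 1 / Suc k"
      if "s \<in> ball 0 (1 / Suc j) - {0}" "t \<in> ball 0 (1 / Suc j) - {0}" for s t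
      unfolding e(2) using r(2)[of s] r(2)[of t] that j by (simp add: dist_real_def)
    then show "\<exists>j::nat. \<forall>s\<in>ball 0 (1 / Suc j) - {0}. \<forall>t\<in>ball 0 (1 / Suc j) - {0}.
      \<bar>(g s - g 0) / s - (g t - g 0) / t\<bar> \<le> 1 / Suc k"
      by blast
  qed
next
  assume C: ?C
  define q where "q t = (g t - g 0) / t" for t
  have C': "\<exists>r>0. \<forall>s t. s \<noteq> 0 \<and> t \<noteq> 0 \<and> \<bar>s\<bar> < r \<and> \<bar>t\<bar> < r \<longrightarrow> \<bar>q s - q t\<bar> < e" if e: "0 < e" for e
  proof -
    obtain k where k: "1 / Suc k < e"
      using nat_approx_posE[OF e] by auto
    obtain j :: nat where j: "\<forall>s\<in>ball 0 (1 / Suc j) - {0}. \<forall>t\<in>ball 0 (1 / Suc j) - {0}. \<bar>q s - q t\<bar> \<le> 1 / Suc k"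
      using C unfolding q_def by blast
    then have "\<bar>q s - q t\<bar> < e" if "s \<noteq> 0" "t \<noteq> 0" "\<bar>s\<bar> < 1 / Suc j" "\<bar>t\<bar> < 1 / Suc j" for s t
    proof -
      have "s \<in> ball 0 (1 / Suc j) - {0}" "t \<in> ball 0 (1 / Suc j) - {0}"
        using that by (simp_all add: dist_real_def)
      then have "\<bar>q s - q t\<bar> \<le> 1 / Suc k"
        using j by blast
      then show ?thesis
        using k by linarith
    qed
    then show ?thesis
      by (intro exI[of _ "1 / Suc j"]) auto
  qed
  \<comment> \<open>One sequence of quotients produces the candidate \<open>d\<close> for the
    derivative; condition \<open>C'\<close> then carries the convergence over to all small
    \<open>t\<close>.\<close>
  have "Cauchy (\<lambda>n. q (1 / Suc n))"
  proof (rule metric_CauchyI)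
    fix e :: real assume "0 < e"
    then obtain r where r: "r > 0" "\<And>s t. s \<noteq> 0 \<Longrightarrow> t \<noteq> 0 \<Longrightarrow> \<bar>s\<bar> < r \<Longrightarrow> \<bar>t\<bar> < r \<Longrightarrow> \<bar>q s - q t\<bar> < e"
      using C' by metis
    obtain N where N: "1 / Suc N < r"
      using nat_approx_posE[OF r(1)] by auto
    have "1 / Suc n < r" if "N \<le> n" for n
      using that N by (smt (verit) frac_le of_nat_0_less_iff of_nat_mono zero_less_Suc Suc_le_mono)
    then have "dist (q (1 / Suc m)) (q (1 / Suc n)) < e" if "N \<le> m" "N \<le> n" for m n
      using that r(2)[of "1 / Suc m" "1 / Suc n"] by (auto simp: dist_real_def)
    then show "\<exists>M. \<forall>m\<ge>M. \<forall>n\<ge>M. dist (q (1 / Suc m)) (q (1 / Suc n)) < e"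
      by blast
  qed
  then obtain d where d: "(\<lambda>n. q (1 / Suc n)) \<longlonglongrightarrow> d"
    using Cauchy_convergent_iff convergent_def by blast
  have "(q \<longlongrightarrow> d) (at 0)"
  proof (rule LIM_I)
    fix e :: real assume e: "0 < e"
    then obtain r where r: "r > 0" "\<And>s t. s \<noteq> 0 \<Longrightarrow> t \<noteq> 0 \<Longrightarrow> \<bar>s\<bar> < r \<Longrightarrow> \<bar>t\<bar> < r \<Longrightarrow> \<bar>q s - q t\<bar> < e / 2"
      using C'[of "e / 2"] by (metis half_gt_zero)
    have "\<bar>q s - d\<bar> < e" if s: "s \<noteq> 0" "\<bar>s\<bar> < r" for s
    proof -
      have "\<forall>\<^sub>F n in sequentially. \<bar>q s - q (1 / Suc n)\<bar> \<le> e / 2"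
        using eventually_compose_filterlim[OF order_tendstoD(2)[OF lim_inverse_n' r(1)] filterlim_Suc]
        by eventually_elim (use r(2)[OF s(1)] s in \<open>auto intro: less_imp_le\<close>)
      moreover have "(\<lambda>n. \<bar>q s - q (1 / Suc n)\<bar>) \<longlonglongrightarrow> \<bar>q s - d\<bar>"
        by (intro tendsto_intros d)
      ultimately have "\<bar>q s - d\<bar> \<le> e / 2"
        by (intro tendsto_upperbound[of _ "\<bar>q s - d\<bar>" sequentially]) auto
      then show ?thesis using e by simp
    qed
    then show "\<exists>r>0. \<forall>t. t \<noteq> 0 \<and> norm (t - 0) < r \<longrightarrow> norm (q t - d) < e"
      using r(1) by auto
  qed
  then have "(g has_real_derivative d) (at 0)"
    by (simp add: DERIV_def q_def[abs_def])
  then show ?D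
    using real_differentiable_def by blast
qed

lemma lipschitz_imp_AE_directional_derivative:
  fixes f :: "'a::euclidean_space \<Rightarrow> real"
  assumes lip: "L-lipschitz_on UNIV f"
  shows "AE x in lborel. (\<lambda>t. f (x + t *\<^sub>R v)) differentiable at 0"
proof -
  have contf: "continuous_on UNIV f"
    using lip by (rule lipschitz_on_continuous_on)
  define E where "E = {x. \<not> (\<lambda>t. f (x + t *\<^sub>R v)) differentiable at 0}"
  define q where "q x t = (f (x + t *\<^sub>R v) - f x) / t" for x t
  \<comment> \<open>Measurability of \<open>E\<close>: the intersections over \<open>s\<close> and
    \<open>t\<close> are uncountable, but they are intersections of closed sets and hence closed.
    Only the operations over \<open>j\<close> and \<open>k\<close> have to be countable.\<close>
  have "- E = (\<Inter>k::nat. \<Union>j::nat. \<Inter>s\<in>ball 0 (1 / Suc j) - {0}. \<Inter>t\<in>ball 0 (1 / Suc j) - {0}.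
      {x. \<bar>q x s - q x t\<bar> \<le> 1 / Suc k})"
    by (intro set_eqI) (simp add: E_def differentiable_at_0_iff_Cauchy q_def)
  moreover have "closed {x. \<bar>q x s - q x t\<bar> \<le> e}" if "s \<noteq> 0" "t \<noteq> 0" for s t e
    unfolding q_def using that
    by (intro closed_Collect_le continuous_intros continuous_on_compose2[OF contf]) auto
  then have "closed (\<Inter>s\<in>ball 0 (1 / Suc j) - {0}. \<Inter>t\<in>ball 0 (1 / Suc j) - {0}.
      {x. \<bar>q x s - q x t\<bar> \<le> 1 / Suc k})" for j k
    by (intro closed_INT ballI) auto
  ultimately have "- E \<in> sets borel"
    by (auto intro!: sets.countable_INT sets.countable_UN borel_closed)
  then have E[measurable]: "E \<in> sets borel"
    using borel_comp[of "- E"] by simp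
  \<comment> \<open>Tonelli for the unit segments x + [0,1] v and translation invariance replace a decomposition
    of the space into lines parallel to v.\<close>
  have line: "(\<integral>\<^sup>+t. indicator E (x + t *\<^sub>R v) * indicator {0..1} t \<partial>lborel) = 0" for x
  proof -
    have "AE s in lborel. (\<lambda>t. f (x + t *\<^sub>R v)) differentiable at s"
      using lipschitz_on_line[OF lip] by (rule lipschitz_real_imp_AE_differentiable)
    then have "AE s in lborel. indicator E (x + s *\<^sub>R v) * indicator {0..1} s = (0::ennreal)"
    proof (rule AE_mp, intro AE_I2 impI)
      fix s assume "(\<lambda>t. f (x + t *\<^sub>R v)) differentiable at s"
      then have "(\<lambda>t. f (x + t *\<^sub>R v)) \<circ> (\<lambda>t. s + t) differentiable at 0"
        by (intro differentiable_chain_at) (auto intro!: derivative_intros)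
      then have "x + s *\<^sub>R v \<notin> E"
        by (simp add: E_def o_def scaleR_add_left add.assoc)
      then show "indicator E (x + s *\<^sub>R v) * indicator {0..1} s = (0::ennreal)"
        by simp
    qed
    then show ?thesis
      by (subst nn_integral_0_iff_AE) auto
  qed
  have transl: "(\<integral>\<^sup>+x. indicator E (x + t *\<^sub>R v) \<partial>lborel) = emeasure lborel E" for t
  proof -
    have "emeasure lborel E = (\<integral>\<^sup>+x. indicator E x \<partial>distr lborel borel ((+) (t *\<^sub>R v)))"
      by (simp add: lborel_distr_plus)
    also have "\<dots> = (\<integral>\<^sup>+x. indicator E (x + t *\<^sub>R v) \<partial>lborel)"
      by (subst nn_integral_distr) (auto simp: add.commute)
    finally show ?thesis by simp
  qed
  have "emeasure lborel E = (\<integral>\<^sup>+t. emeasure lborel E * indicator {0..1::real} t \<partial>lborel)"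
    by (simp add: nn_integral_cmult)
  also have "\<dots> = (\<integral>\<^sup>+t. (\<integral>\<^sup>+x. indicator E (x + t *\<^sub>R v) * indicator {0..1} t \<partial>lborel) \<partial>lborel)"
    by (simp add: nn_integral_multc transl)
  also have "\<dots> = (\<integral>\<^sup>+x. (\<integral>\<^sup>+t. indicator E (x + t *\<^sub>R v) * indicator {0..1} t \<partial>lborel) \<partial>lborel)"
    by (rule lborel_pair.Fubini') measurable
  finally have "emeasure lborel E = 0"
    by (simp add: line)
  then have "AE x in lborel. x \<notin> E"
    by (intro AE_not_in) (simp add: null_sets_def)
  then show ?thesis
    by (simp add: E_def)
qed

section \<open>Linearity of the derivative in the direction\<close>

definition diff_quot :: "('a::real_normed_vector \<Rightarrow> real) \<Rightarrow> 'a \<Rightarrow> nat \<Rightarrow> 'a \<Rightarrow> real" where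
  "diff_quot f v n x = real (Suc n) * (f (x + (1 / real (Suc n)) *\<^sub>R v) - f x)"

text \<open>A limit along a sequence of step lengths, so that for continuous \<open>f\<close> it is
  Borel measurable in \<open>x\<close>. It is total, and it agrees with the directional derivative
  wherever that exists.\<close>

definition dir_deriv :: "('a::real_normed_vector \<Rightarrow> real) \<Rightarrow> 'a \<Rightarrow> 'a \<Rightarrow> real" where
  "dir_deriv f v x = lim (\<lambda>n. diff_quot f v n x)"

lemma diff_quot_tendsto:
  assumes "((\<lambda>t. f (x + t *\<^sub>R v)) has_real_derivative d) (at 0)"
  shows "(\<lambda>n. diff_quot f v n x) \<longlonglongrightarrow> d"
proof -
  have "((\<lambda>t. (f (x + t *\<^sub>R v) - f x) / t) \<longlongrightarrow> d) (at 0)"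
    using assms by (simp add: DERIV_def)
  moreover have "(\<lambda>n. 1 / real (Suc n)) \<longlonglongrightarrow> 0"
    using LIMSEQ_inverse_real_of_nat by (simp add: inverse_eq_divide)
  ultimately have "((\<lambda>t. (f (x + t *\<^sub>R v) - f x) / t) \<circ> (\<lambda>n. 1 / real (Suc n))) \<longlonglongrightarrow> d"
    unfolding tendsto_at_iff_sequentially by auto
  then show ?thesis
    by (simp add: o_def diff_quot_def mult.commute del: of_nat_Suc)
qed

lemma dir_deriv_eqI:
  "((\<lambda>t. f (x + t *\<^sub>R v)) has_real_derivative d) (at 0) \<Longrightarrow> dir_deriv f v x = d"
  unfolding dir_deriv_def by (intro limI diff_quot_tendsto)

lemma abs_diff_quot_le:
  assumes "L-lipschitz_on UNIV f"
  shows "\<bar>diff_quot f v n x\<bar> \<le> L * norm v"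
proof -
  have "\<bar>f (x + (1 / real (Suc n)) *\<^sub>R v) - f x\<bar> \<le> L * norm ((1 / real (Suc n)) *\<^sub>R v)"
    using lipschitz_on_normD[OF assms, of "x + (1 / real (Suc n)) *\<^sub>R v" x] by simp
  then have "real (Suc n) * \<bar>f (x + (1 / real (Suc n)) *\<^sub>R v) - f x\<bar> \<le> real (Suc n) * (L * norm ((1 / real (Suc n)) *\<^sub>R v))"
    by (rule mult_left_mono) simp
  also have "\<dots> = L * norm v"
    by (simp add: field_simps)
  finally show ?thesis
    by (simp add: diff_quot_def abs_mult)
qed

lemma AE_has_dir_deriv:
  fixes f :: "'a::euclidean_space \<Rightarrow> real"
  assumes "L-lipschitz_on UNIV f"
  shows "AE x in lborel. ((\<lambda>t. f (x + t *\<^sub>R v)) has_real_derivative dir_deriv f v x) (at 0)"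
  using lipschitz_imp_AE_directional_derivative[OF assms, of v]
proof (rule AE_mp, intro AE_I2 impI)
  fix x assume "(\<lambda>t. f (x + t *\<^sub>R v)) differentiable at 0"
  then obtain d where "((\<lambda>t. f (x + t *\<^sub>R v)) has_real_derivative d) (at 0)"
    using real_differentiable_def by blast
  then show "((\<lambda>t. f (x + t *\<^sub>R v)) has_real_derivative dir_deriv f v x) (at 0)"
    using dir_deriv_eqI by fastforce
qed

text \<open>Lebesgue differentiation: at almost every point the value is the limit of averages over
  shrinking cubes with a corner there, and all these averages vanish.\<close>

lemma AE_eq_0_if_integral_cbox_eq_0:
  fixes g :: "'a::euclidean_space \<Rightarrow> real"
  assumes "\<And>a b. (g has_integral 0) (cbox a b)"
  shows "AE x in lborel. g x = 0"
proof -
  have "g integrable_on cbox a b" for a b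
    using assms by blast
  then obtain N where N: "negligible N"
    and g: "\<And>x e. x \<notin> N \<Longrightarrow> 0 < e \<Longrightarrow> \<exists>d>0. \<forall>h. 0 < h \<and> h < d \<longrightarrow>
        norm (integral (cbox x (x + h *\<^sub>R One)) g /\<^sub>R h ^ DIM('a) - g x) < e"
    by (rule integrable_ccontinuous_explicit) blast
  have "g x = 0" if xN: "x \<notin> N" for x
  proof (rule ccontr)
    assume "g x \<noteq> 0"
    then obtain d where "d > 0" and d: "\<forall>h. 0 < h \<and> h < d \<longrightarrow>
        norm (integral (cbox x (x + h *\<^sub>R One)) g /\<^sub>R h ^ DIM('a) - g x) < \<bar>g x\<bar>"
      using g[OF xN, of "\<bar>g x\<bar>"] by auto
    with d[rule_format, of "d / 2"] show False
      by (simp add: integral_unique[OF assms])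
  qed
  moreover have "AE x in lebesgue. x \<notin> N"
    using N unfolding negligible_iff_null_sets by (rule AE_not_in)
  ultimately have "AE x in lebesgue. g x = 0"
    by (elim AE_mp) auto
  then show ?thesis
    by (simp add: AE_completion_iff)
qed

lemma integrable_indicator_mult_bounded:
  fixes g :: "'a::euclidean_space \<Rightarrow> real"
  assumes [measurable]: "g \<in> borel_measurable borel" "B \<in> sets borel"
    and "bounded B" "AE x in lborel. \<bar>g x\<bar> \<le> M"
  shows "integrable lborel (\<lambda>x. indicator B x * g x)"
proof (rule Bochner_Integration.integrable_bound)
  show "integrable lborel (\<lambda>x. indicator B x * M)"
    using emeasure_bounded_finite[OF \<open>bounded B\<close>] by (intro integrable_mult_left integrable_real_indicator) auto
  show "AE x in lborel. norm (indicator B x * g x) \<le> norm (indicator B x * M)"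
    using assms(4) by eventually_elim (auto simp: indicator_def)
qed measurable

text \<open>At a single point, directional derivatives may exist without being additive in the
  direction, so additivity is first shown for integrals over boxes. The quotient along
  \<open>u + v\<close> is a quotient along \<open>u\<close> plus a quotient along \<open>v\<close>
  at a point moved by a vector tending to 0. Dominated convergence removes the shift in the
  limit.\<close>

lemma AE_dir_deriv_add:
  fixes f :: "'a::euclidean_space \<Rightarrow> real"
  assumes lip: "L-lipschitz_on UNIV f"
  shows "AE x in lborel. dir_deriv f (u + v) x = dir_deriv f u x + dir_deriv f v x"
proof -
  have [measurable]: "f \<in> borel_measurable borel"
    using lip by (intro borel_measurable_continuous_onI lipschitz_on_continuous_on)
  have dq[measurable]: "diff_quot f w n \<in> borel_measurable borel" for w n
    unfolding diff_quot_def by measurable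
  have [measurable]: "dir_deriv f w \<in> borel_measurable borel" for w
    unfolding dir_deriv_def by (intro borel_measurable_lim_metric dq)
  have conv: "AE x in lborel. (\<lambda>n. diff_quot f w n x) \<longlonglongrightarrow> dir_deriv f w x" for w
    using AE_has_dir_deriv[OF lip, of w] by eventually_elim (rule diff_quot_tendsto)
  have bound: "AE x in lborel. \<bar>dir_deriv f w x\<bar> \<le> L * norm w" for w
    using conv[of w]
  proof eventually_elim
    fix x assume "(\<lambda>n. diff_quot f w n x) \<longlonglongrightarrow> dir_deriv f w x"
    then show "\<bar>dir_deriv f w x\<bar> \<le> L * norm w"
      by (rule tendsto_upperbound[OF tendsto_rabs]) (auto simp: abs_diff_quot_le[OF lip])
  qed
  have "((\<lambda>x. dir_deriv f (u + v) x - dir_deriv f u x - dir_deriv f v x) has_integral 0) (cbox a b)" for a b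
  proof -
    define B where "B = cbox a b"
    have B[measurable]: "B \<in> sets borel" and bB: "bounded B"
      by (auto simp: B_def)
    have int_dd: "integrable lborel (\<lambda>x. indicator B x * dir_deriv f w x)" for w
      using bound by (intro integrable_indicator_mult_bounded bB) auto
    have int_dq: "integrable lborel (\<lambda>x. indicator B x * diff_quot f w n x)" for w n
      using abs_diff_quot_le[OF lip] by (intro integrable_indicator_mult_bounded bB) auto
    have int_dq': "integrable lborel (\<lambda>x. indicator B x * diff_quot f w n (x + c))" for w n c
      using abs_diff_quot_le[OF lip] by (intro integrable_indicator_mult_bounded bB) auto
    have lim: "(\<lambda>n. \<integral>x. indicator B x * diff_quot f w n x \<partial>lborel)
        \<longlonglongrightarrow> (\<integral>x. indicator B x * dir_deriv f w x \<partial>lborel)" for w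
    proof (rule integral_dominated_convergence)
      show "integrable lborel (\<lambda>x. indicator B x * (L * norm w))"
        using bB by (intro integrable_indicator_mult_bounded) auto
      show "AE x in lborel. (\<lambda>n. indicator B x * diff_quot f w n x) \<longlonglongrightarrow> indicator B x * dir_deriv f w x"
        using conv[of w] by eventually_elim (intro tendsto_intros)
      show "AE x in lborel. norm (indicator B x * diff_quot f w n x) \<le> indicator B x * (L * norm w)" for n
        by (auto simp: indicator_def abs_diff_quot_le[OF lip])
    qed measurable
    define c where "c n = (1 / real (Suc n)) *\<^sub>R u" for n
    have c0: "c \<longlonglongrightarrow> 0"
    proof -
      have "(\<lambda>n. 1 / real (Suc n)) \<longlonglongrightarrow> 0"
        using LIMSEQ_inverse_real_of_nat by (simp add: inverse_eq_divide)
      from tendsto_scaleR[OF this tendsto_const[of u]] show ?thesis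
        by (simp add: c_def[abs_def])
    qed
    have c_le: "norm (c n) \<le> norm u" for n
      by (simp add: c_def divide_simps mult_le_cancel_left1)
    have split: "diff_quot f (u + v) n x = diff_quot f v n (x + c n) + diff_quot f u n x" for n x
      by (simp add: diff_quot_def c_def scaleR_add_right algebra_simps)
    \<comment> \<open>Shifting the argument of the difference quotient moves the box instead, and
      the moved boxes converge to B off the frontier of B.\<close>
    have shift: "(\<integral>x. indicator B x * diff_quot f v n (x + c n) \<partial>lborel)
        = (\<integral>x. indicator B (x - c n) * diff_quot f v n x \<partial>lborel)" for n
    proof -
      have "(\<integral>x. indicator B (x - c n) * diff_quot f v n x \<partial>lborel)
          = (\<integral>x. indicator B (x - c n) * diff_quot f v n x \<partial>distr lborel borel ((+) (c n)))"
        by (simp add: lborel_distr_plus)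
      also have "\<dots> = (\<integral>x. indicator B x * diff_quot f v n (x + c n) \<partial>lborel)"
        by (subst integral_distr) (auto simp: add.commute)
      finally show ?thesis by simp
    qed
    \<comment> \<open>All the shifted boxes lie in the ball of radius \<open>r + norm u\<close>,
      since \<open>c n\<close> is never longer than \<open>u\<close>. This yields a single
      dominating function.\<close>
    obtain r where r: "\<And>x. x \<in> B \<Longrightarrow> norm x \<le> r"
      using bB by (auto simp: bounded_iff)
    have lim_shift: "(\<lambda>n. \<integral>x. indicator B (x - c n) * diff_quot f v n x \<partial>lborel)
        \<longlonglongrightarrow> (\<integral>x. indicator B x * dir_deriv f v x \<partial>lborel)"
    proof (rule integral_dominated_convergence)
      show "integrable lborel (\<lambda>x. indicator (cball 0 (r + norm u)) x * (L * norm v))"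
        by (intro integrable_indicator_mult_bounded) auto
      have "negligible (frontier B)"
        unfolding B_def by (intro negligible_convex_frontier convex_box)
      then have "AE x in lborel. x \<notin> frontier B"
        unfolding negligible_iff_null_sets by (metis AE_not_in AE_completion_iff)
      then show "AE x in lborel. (\<lambda>n. indicator B (x - c n) * diff_quot f v n x) \<longlonglongrightarrow> indicator B x * dir_deriv f v x"
        using conv[of v]
      proof eventually_elim
        fix x assume x: "x \<notin> frontier B" and dq: "(\<lambda>n. diff_quot f v n x) \<longlonglongrightarrow> dir_deriv f v x"
        have xc: "(\<lambda>n. x - c n) \<longlonglongrightarrow> x"
          using tendsto_diff[OF tendsto_const c0] by simp
        have "\<forall>\<^sub>F n in sequentially. indicator B (x - c n) = (indicator B x :: real)"
        proof (cases "x \<in> B")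
          case True
          then have "x \<in> interior B"
            using x closure_subset by (auto simp: frontier_def)
          from topological_tendstoD[OF xc open_interior this] show ?thesis
            using True interior_subset[of B] by (auto elim!: eventually_mono)
        next
          case False
          have "open (- B)" by (auto simp: B_def intro!: open_Compl closed_cbox)
          from topological_tendstoD[OF xc this] False show ?thesis
            by (auto elim!: eventually_mono)
        qed
        then have "(\<lambda>n. indicator B (x - c n) :: real) \<longlonglongrightarrow> indicator B x"
          by (rule tendsto_eventually)
        then show "(\<lambda>n. indicator B (x - c n) * diff_quot f v n x) \<longlonglongrightarrow> indicator B x * dir_deriv f v x"
          using dq by (rule tendsto_mult)
      qed
      show "AE x in lborel. norm (indicator B (x - c n) * diff_quot f v n x)
          \<le> indicator (cball 0 (r + norm u)) x * (L * norm v)" for n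
      proof (rule AE_I2)
        fix x
        have "x \<in> cball 0 (r + norm u)" if "x - c n \<in> B"
          using r[OF that] c_le[of n] norm_triangle_ineq[of "x - c n" "c n"] by simp
        then show "norm (indicator B (x - c n) * diff_quot f v n x)
          \<le> indicator (cball 0 (r + norm u)) x * (L * norm v)"
          using abs_diff_quot_le[OF lip, of v n x] lipschitz_on_nonneg[OF lip]
          by (auto simp: indicator_def)
      qed
    qed measurable
    have "(\<integral>x. indicator B x * diff_quot f (u + v) n x \<partial>lborel)
        = (\<integral>x. indicator B (x - c n) * diff_quot f v n x \<partial>lborel) + (\<integral>x. indicator B x * diff_quot f u n x \<partial>lborel)" for n
      unfolding shift[symmetric] split distrib_left
      by (rule Bochner_Integration.integral_add[OF int_dq' int_dq])
    then have "(\<lambda>n. \<integral>x. indicator B x * diff_quot f (u + v) n x \<partial>lborel)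
        \<longlonglongrightarrow> (\<integral>x. indicator B x * dir_deriv f v x \<partial>lborel) + (\<integral>x. indicator B x * dir_deriv f u x \<partial>lborel)"
      using tendsto_add[OF lim_shift lim[of u]] by simp
    then have eq: "(\<integral>x. indicator B x * dir_deriv f (u + v) x \<partial>lborel)
        = (\<integral>x. indicator B x * dir_deriv f v x \<partial>lborel) + (\<integral>x. indicator B x * dir_deriv f u x \<partial>lborel)"
      using lim[of "u + v"] LIMSEQ_unique by blast
    have "((\<lambda>x. indicator B x * dir_deriv f (u + v) x - indicator B x * dir_deriv f u x
        - indicator B x * dir_deriv f v x) has_integral 0) UNIV"
      using has_integral_diff[OF has_integral_diff[OF has_integral_integral_lborel[OF int_dd[of "u + v"]]
        has_integral_integral_lborel[OF int_dd[of u]]] has_integral_integral_lborel[OF int_dd[of v]]]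
      by (simp add: eq)
    then have "((\<lambda>x. if x \<in> B then dir_deriv f (u + v) x - dir_deriv f u x - dir_deriv f v x else 0) has_integral 0) UNIV"
      by (rule has_integral_eq[rotated]) auto
    then show ?thesis
      unfolding has_integral_restrict_UNIV by (simp add: B_def)
  qed
  from AE_eq_0_if_integral_cbox_eq_0[OF this] show ?thesis
    by eventually_elim simp
qed

lemma AE_dir_deriv_scale:
  fixes f :: "'a::euclidean_space \<Rightarrow> real"
  assumes lip: "L-lipschitz_on UNIV f"
  shows "AE x in lborel. dir_deriv f (c *\<^sub>R v) x = c * dir_deriv f v x"
  using AE_has_dir_deriv[OF lip, of v]
proof eventually_elim
  fix x assume "((\<lambda>t. f (x + t *\<^sub>R v)) has_real_derivative dir_deriv f v x) (at 0)"
  then have "((\<lambda>t. f (x + t *\<^sub>R v)) \<circ> (\<lambda>t. t * c) has_real_derivative dir_deriv f v x * c) (at 0)"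
    by (intro DERIV_chain) (auto intro!: derivative_eq_intros)
  then show "dir_deriv f (c *\<^sub>R v) x = c * dir_deriv f v x"
    by (intro dir_deriv_eqI) (simp add: o_def mult.commute)
qed

text \<open>Additivity and homogeneity are applied to the expansion of \<open>v\<close> in the
  standard basis. The exceptional null set may depend on \<open>v\<close>.\<close>

lemma AE_dir_deriv_linear:
  fixes f :: "'a::euclidean_space \<Rightarrow> real"
  assumes lip: "L-lipschitz_on UNIV f"
  shows "AE x in lborel. dir_deriv f v x = (\<Sum>b\<in>Basis. (v \<bullet> b) * dir_deriv f b x)"
proof -
  have "AE x in lborel. dir_deriv f (\<Sum>b\<in>I. (v \<bullet> b) *\<^sub>R b) x = (\<Sum>b\<in>I. (v \<bullet> b) * dir_deriv f b x)"
    if "finite I" for I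
    using that
  proof induction
    case empty
    have "dir_deriv f 0 x = 0" for x
      by (rule dir_deriv_eqI) simp
    then show ?case by simp
  next
    case (insert a I)
    show ?case
      using insert.IH AE_dir_deriv_scale[OF lip, of "v \<bullet> a" a]
        AE_dir_deriv_add[OF lip, of "(v \<bullet> a) *\<^sub>R a" "\<Sum>b\<in>I. (v \<bullet> b) *\<^sub>R b"]
      by eventually_elim (simp add: insert.hyps)
  qed
  from this[OF finite_Basis] show ?thesis
    by (simp add: euclidean_representation)
qed

section \<open>From directional derivatives to total derivatives\<close>

text \<open>By compactness, finitely many directions from \<open>Q\<close> come close to every unit
  vector, and the quotients along these converge uniformly. The Lipschitz bound on \<open>f\<close>
  and the boundedness of \<open>A\<close> transfer the estimate to every direction.\<close>

lemma has_derivative_if_dense_dir_derivs: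
  fixes f :: "'a::euclidean_space \<Rightarrow> real"
  assumes lip: "L-lipschitz_on UNIV f" and A: "bounded_linear A"
    and Q: "\<And>X. open X \<Longrightarrow> X \<noteq> {} \<Longrightarrow> \<exists>q\<in>Q. q \<in> X"
    and dir: "\<And>q. q \<in> Q \<Longrightarrow> ((\<lambda>t. f (x + t *\<^sub>R q)) has_real_derivative A q) (at 0)"
  shows "(f has_derivative A) (at x)"
  unfolding has_derivative_at_alt
proof (intro conjI allI impI A)
  fix e :: real assume e: "0 < e"
  interpret A: bounded_linear A by (rule A)
  obtain M where M: "0 \<le> M" "\<And>v. \<bar>A v\<bar> \<le> norm v * M"
    using A.nonneg_bounded by auto
  have L: "0 \<le> L" using lip by (rule lipschitz_on_nonneg)
  \<comment> \<open>Three errors have to add up to \<open>e\<close>: \<open>L * \<eta>\<close> from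
    changing the direction in \<open>f\<close>, \<open>\<eta>\<close> from the difference quotient,
    and \<open>M * \<eta>\<close> from changing the direction in \<open>A\<close>.\<close>
  define \<eta> where "\<eta> = e / (L + M + 1)"
  have \<eta>: "0 < \<eta>" using e L M by (simp add: \<eta>_def)
  have \<eta>e: "(L + M + 1) * \<eta> = e" using L M by (simp add: \<eta>_def)
  have "sphere 0 1 \<subseteq> (\<Union>q\<in>Q. ball q \<eta>)"
  proof
    fix u :: 'a
    obtain q where "q \<in> Q" "q \<in> ball u \<eta>"
      using Q[of "ball u \<eta>"] \<eta> by auto
    then show "u \<in> (\<Union>q\<in>Q. ball q \<eta>)"
      by (auto simp: dist_commute)
  qed
  then obtain Q' where Q': "Q' \<subseteq> Q" "finite Q'" "sphere 0 1 \<subseteq> (\<Union>q\<in>Q'. ball q \<eta>)"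
    using compactE_image[OF compact_sphere, of Q "\<lambda>q. ball q \<eta>" "0::'a" 1] by auto
  have "\<forall>\<^sub>F t in at 0. \<bar>(f (x + t *\<^sub>R q) - f x) / t - A q\<bar> < \<eta>" if "q \<in> Q'" for q
  proof -
    have "((\<lambda>t. (f (x + t *\<^sub>R q) - f x) / t) \<longlongrightarrow> A q) (at 0)"
      using dir[of q] that Q'(1) by (auto simp: DERIV_def)
    from tendstoD[OF this \<eta>] show ?thesis
      by (simp add: dist_real_def)
  qed
  then have "\<forall>\<^sub>F t in at 0. \<forall>q\<in>Q'. \<bar>(f (x + t *\<^sub>R q) - f x) / t - A q\<bar> < \<eta>"
    using Q'(2) by (simp add: eventually_ball_finite_distrib)
  then obtain d where d: "d > 0"
    "\<And>t q. t \<noteq> 0 \<Longrightarrow> \<bar>t\<bar> < d \<Longrightarrow> q \<in> Q' \<Longrightarrow> \<bar>(f (x + t *\<^sub>R q) - f x) / t - A q\<bar> < \<eta>"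
    by (auto simp: eventually_at dist_real_def)
  have "norm (f y - f x - A (y - x)) \<le> e * norm (y - x)" if y: "norm (y - x) < d" for y
  proof (cases "y = x")
    case False
    define t where "t = norm (y - x)"
    define u where "u = (y - x) /\<^sub>R t"
    have t: "0 < t" and tu: "y = x + t *\<^sub>R u" and u: "norm u = 1"
      using False by (auto simp: t_def u_def)
    then obtain q where q: "q \<in> Q'" "norm (u - q) < \<eta>"
      using Q'(3) by (force simp: dist_norm norm_minus_commute)
    have "\<bar>f (x + t *\<^sub>R u) - f (x + t *\<^sub>R q)\<bar> \<le> L * norm (t *\<^sub>R (u - q))"
      using lipschitz_on_normD[OF lip, of "x + t *\<^sub>R u" "x + t *\<^sub>R q"] by (simp add: scaleR_diff_right)
    also have "\<dots> \<le> L * (t * \<eta>)"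
      using q t L by (intro mult_left_mono) auto
    finally have 1: "\<bar>f (x + t *\<^sub>R u) - f (x + t *\<^sub>R q)\<bar> \<le> L * \<eta> * t"
      by (simp add: mult_ac)
    have "\<bar>(f (x + t *\<^sub>R q) - f x) / t - A q\<bar> * t \<le> \<eta> * t"
      using d(2)[of t q] t q y by (intro mult_right_mono) (auto simp: t_def)
    also have "\<bar>(f (x + t *\<^sub>R q) - f x) / t - A q\<bar> * t = \<bar>((f (x + t *\<^sub>R q) - f x) / t - A q) * t\<bar>"
      using t by (simp add: abs_mult)
    also have "((f (x + t *\<^sub>R q) - f x) / t - A q) * t = f (x + t *\<^sub>R q) - f x - t * A q"
      using t by (simp add: field_simps)
    finally have 2: "\<bar>f (x + t *\<^sub>R q) - f x - t * A q\<bar> \<le> \<eta> * t" .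
    have "\<bar>t * A q - t * A u\<bar> = t * \<bar>A (q - u)\<bar>"
      using t by (simp add: A.diff abs_mult flip: right_diff_distrib)
    also have "\<dots> \<le> t * (\<eta> * M)"
      using M q t by (intro mult_left_mono order_trans[OF M(2)] mult_right_mono) (auto simp: norm_minus_commute)
    finally have 3: "\<bar>t * A q - t * A u\<bar> \<le> M * \<eta> * t"
      by (simp add: mult_ac)
    have "\<bar>f (x + t *\<^sub>R u) - f x - t * A u\<bar> \<le> L * \<eta> * t + \<eta> * t + M * \<eta> * t"
      using 1 2 3 by linarith
    also have "\<dots> = (L + M + 1) * \<eta> * t"
      by (simp add: algebra_simps)
    finally show ?thesis
      using t by (simp add: \<eta>e tu A.scaleR u)
  qed (simp add: A.zero)
  then show "\<exists>d>0. \<forall>y. norm (y - x) < d \<longrightarrow> norm (f y - f x - A (y - x)) \<le> e * norm (y - x)"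
    using d(1) by blast
qed

text \<open>The null sets belonging to the directions in a countable dense set have a null union.
  Outside it, the directional derivatives along the dense set come from one linear map.\<close>

lemma lipschitz_imp_AE_differentiable_real_valued:
  fixes f :: "'a::euclidean_space \<Rightarrow> real"
  assumes lip: "L-lipschitz_on UNIV f"
  shows "AE x in lborel. f differentiable at x"
proof -
  obtain Q :: "'a set" where Q: "countable Q" "\<And>X. open X \<Longrightarrow> X \<noteq> {} \<Longrightarrow> \<exists>q\<in>Q. q \<in> X"
    using countable_dense_setE by metis
  have "AE x in lborel. \<forall>q\<in>Q. dir_deriv f q x = (\<Sum>b\<in>Basis. (q \<bullet> b) * dir_deriv f b x) \<and>
      ((\<lambda>t. f (x + t *\<^sub>R q)) has_real_derivative dir_deriv f q x) (at 0)"
    using AE_dir_deriv_linear[OF lip] AE_has_dir_deriv[OF lip] Q(1)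
    by (auto simp: AE_ball_countable)
  then show ?thesis
  proof eventually_elim
    fix x assume x: "\<forall>q\<in>Q. dir_deriv f q x = (\<Sum>b\<in>Basis. (q \<bullet> b) * dir_deriv f b x) \<and>
      ((\<lambda>t. f (x + t *\<^sub>R q)) has_real_derivative dir_deriv f q x) (at 0)"
    have "bounded_linear (\<lambda>v. \<Sum>b\<in>Basis. (v \<bullet> b) * dir_deriv f b x)"
      by (intro bounded_linear_intros)
    then have "(f has_derivative (\<lambda>v. \<Sum>b\<in>Basis. (v \<bullet> b) * dir_deriv f b x)) (at x)"
      using lip Q(2) x by (intro has_derivative_if_dense_dir_derivs) auto
    then show "f differentiable at x"
      by (rule differentiableI)
  qed
qed

theorem lipschitz_imp_AE_differentiable:
  fixes F :: "'a::euclidean_space \<Rightarrow> 'b::euclidean_space"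
  assumes lip: "L-lipschitz_on UNIV F"
  shows "AE x in lborel. F differentiable at x"
proof -
  have "L-lipschitz_on UNIV (\<lambda>x. F x \<bullet> b)" if b: "b \<in> Basis" for b
  proof (rule lipschitz_onI)
    show "dist (F x \<bullet> b) (F y \<bullet> b) \<le> L * dist x y" for x y
      using lipschitz_on_normD[OF lip, of x y] Basis_le_norm[OF b, of "F x - F y"]
      by (simp add: dist_real_def dist_norm inner_diff_left)
  qed (rule lipschitz_on_nonneg[OF lip])
  then have "AE x in lborel. \<forall>b\<in>Basis. (\<lambda>x. F x \<bullet> b) differentiable at x"
    by (intro AE_finite_allI finite_Basis lipschitz_imp_AE_differentiable_real_valued)
  then show ?thesis
    by eventually_elim (simp add: differentiable_componentwise_within[of F])
qed

lemma negligible_not_differentiable_lipschitz: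
  fixes F :: "'a::euclidean_space \<Rightarrow> 'b::euclidean_space"
  assumes "L-lipschitz_on UNIV F"
  shows "negligible {x. \<not> F differentiable at x}"
  using AE_completion[OF lipschitz_imp_AE_differentiable[OF assms]]
  by (simp add: negligible_iff_null_sets AE_iff_null_sets eventually_ae_filter) (metis (lifting) completion.complete2)

section \<open>Critical values of Lipschitz maps\<close>

lemma measure_slab_le:
  fixes a :: "'a::euclidean_space"
  assumes a: "norm a = 1" and R: "0 < R" and e: "0 < e" "e \<le> 1"
  shows "measure lebesgue {y \<in> cball 0 R. \<bar>a \<bullet> y\<bar> \<le> e * R}
           \<le> 2 * e * measure lebesgue (cball (0::'a) (4 * R))"
proof -
  define T where "T = {y \<in> cball 0 R. \<bar>a \<bullet> y\<bar> \<le> e * R}"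
  have "closed {y. \<bar>a \<bullet> y\<bar> \<le> e * R}"
    by (intro closed_Collect_le continuous_intros)
  then have "compact T"
    unfolding T_def Collect_conj_eq by (metis Collect_mem_eq compact_Int_closed compact_cball)
  then have T: "T \<in> lmeasurable"
    by (rule lmeasurable_compact)
  \<comment> \<open>The number of translates: \<open>m * e \<le> 1\<close> keeps them within
    distance \<open>4 * R\<close> of the origin, and \<open>1 < 2 * e * m\<close> makes them
    numerous enough for the bound. Their spacing \<open>3 * e * R\<close> exceeds the thickness
    \<open>2 * e * R\<close> of the slab.\<close>
  define m where "m = nat \<lfloor>1 / e\<rfloor>"
  have m1: "1 \<le> m"
    using e by (simp add: m_def le_nat_iff)
  have m2: "real m * e \<le> 1"
    using e of_int_floor_le[of "1 / e"] by (simp add: m_def pos_le_divide_eq del: of_int_floor_le)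
  have "1 / e < real m + 1"
    using e by (simp add: m_def)
  then have m3: "1 < 2 * e * real m"
  proof -
    have "1 / e < 2 * real m"
      using \<open>1 / e < real m + 1\<close> m1 by linarith
    then show ?thesis
      using e by (simp add: pos_divide_less_eq mult.commute mult.left_commute)
  qed
  \<comment> \<open>Disjoint translates of the slab along its normal are packed into a ball.\<close>
  define U where "U k = (+) ((3 * real k * e * R) *\<^sub>R a) ` T" for k
  have U: "U k \<in> lmeasurable" for k
    by (simp add: U_def T measurable_translation)
  have Um: "measure lebesgue (U k) = measure lebesgue T" for k
    by (simp add: U_def measure_translation)
  have Ua: "\<bar>a \<bullet> y - 3 * real k * e * R\<bar> \<le> e * R" if "y \<in> U k" for y k
    using that a by (auto simp: U_def T_def inner_add_right dot_square_norm)
  have disj: "pairwise (\<lambda>i j. disjnt (U i) (U j)) {..<m}"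
    unfolding pairwise_def
  proof (intro ballI impI)
    fix i j :: nat assume "i \<noteq> j"
    then have "1 \<le> \<bar>real i - real j\<bar>" by linarith
    then have "3 * (e * R) \<le> 3 * (e * R) * \<bar>real i - real j\<bar>"
      using e R by simp
    also have "\<dots> = \<bar>3 * real i * e * R - 3 * real j * e * R\<bar>"
    proof -
      have "3 * real i * e * R - 3 * real j * e * R = 3 * (e * R) * (real i - real j)"
        by (simp add: algebra_simps)
      then show ?thesis
        using e R by (simp add: abs_mult)
    qed
    finally have "3 * (e * R) \<le> \<bar>3 * real i * e * R - 3 * real j * e * R\<bar>" .
    moreover have "0 < e * R" using e R by simp
    ultimately show "disjnt (U i) (U j)"
      unfolding disjnt_iff using Ua[of _ i] Ua[of _ j] by (smt (verit))
  qed
  have sub: "(\<Union>k<m. U k) \<subseteq> cball 0 (4 * R)"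
  proof clarify
    fix k y assume k: "k < m" and "y \<in> U k"
    then obtain z where z: "norm z \<le> R" "y = (3 * real k * e * R) *\<^sub>R a + z"
      by (auto simp: U_def T_def)
    have "real k * e \<le> 1"
      using k m2 e by (smt (verit) mult_right_mono of_nat_less_iff)
    then have "3 * (real k * e) * R \<le> 3 * R" using R by simp
    then have "norm ((3 * real k * e * R) *\<^sub>R a) \<le> 3 * R"
      using a e R by (simp add: abs_mult mult.assoc)
    then show "y \<in> cball 0 (4 * R)"
      using z norm_triangle_ineq[of "(3 * real k * e * R) *\<^sub>R a" z] by simp
  qed
  have "real m * measure lebesgue T = (\<Sum>k<m. measure lebesgue (U k))"
    by (simp add: Um)
  also have "\<dots> = measure lebesgue (\<Union>k<m. U k)"
    using U disj by (intro measure_UNION'[symmetric]) auto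
  also have "\<dots> \<le> measure lebesgue (cball (0::'a) (4 * R))"
    using U sub by (intro measure_mono_fmeasurable) (auto intro!: sets.finite_UN)
  finally have le: "real m * measure lebesgue T \<le> measure lebesgue (cball (0::'a) (4 * R))" .
  have "measure lebesgue T \<le> (2 * e * real m) * measure lebesgue T"
    using m3 by (simp add: mult_le_cancel_right1)
  also have "\<dots> \<le> 2 * e * measure lebesgue (cball (0::'a) (4 * R))"
    using le e by (simp add: mult.assoc)
  finally show ?thesis
    by (simp add: T_def)
qed

lemma negligible_lipschitz_image:
  fixes F :: "'a::euclidean_space \<Rightarrow> 'a"
  assumes "L-lipschitz_on UNIV F" "negligible S"
  shows "negligible (F ` S)"
proof (rule negligible_locally_Lipschitz_image)
  fix x assume "x \<in> S"
  show "\<exists>T B. open T \<and> x \<in> T \<and> (\<forall>y \<in> S \<inter> T. norm (F y - F x) \<le> B * norm (y - x))"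
    using lipschitz_on_normD[OF assms(1)] by (intro exI[of _ UNIV] exI[of _ L]) auto
qed (use assms in auto)

text \<open>A Sard theorem under mere pointwise differentiability. Near a critical point, small
  balls are mapped into slabs of relatively small volume. Vitali's theorem selects disjoint such
  balls covering all but a null set, so the total volume of the slabs is small, and the remaining
  null set has a null image.\<close>

lemma negligible_critical_values:
  fixes F :: "'a::euclidean_space \<Rightarrow> 'a"
  assumes lip: "L-lipschitz_on UNIV F"
    and der: "\<And>x. x \<in> S \<Longrightarrow> (F has_derivative A x) (at x)"
    and sing: "\<And>x. x \<in> S \<Longrightarrow> \<not> inj (A x)"
  shows "negligible (F ` S)"
proof -
  define M where "M = L + 1"
  have M: "0 < M" and lipM: "norm (F y - F x) \<le> M * norm (y - x)" for x y
    using lipschitz_on_nonneg[OF lip] lipschitz_on_normD[OF lip, of y x]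
    by (auto simp: M_def algebra_simps intro: order_trans)
  \<comment> \<open>Domain and target have equal dimension, so a non-injective derivative is not
    surjective and its range has a unit normal.\<close>
  have normal: "\<exists>a. norm a = 1 \<and> (\<forall>v. a \<bullet> A x v = 0)" if x: "x \<in> S" for x
  proof -
    have lin: "linear (A x)"
      using der[OF x] by (rule has_derivative_linear)
    then have "\<not> surj (A x)"
      using sing[OF x] linear_surjective_imp_injective by blast
    then have "dim (range (A x)) < DIM('a)"
      using lin dim_eq_full[of "range (A x)"] dim_subset_UNIV[of "range (A x)"]
      by (metis le_neq_implies_less linear_subspace_image span_eq_iff subspace_UNIV)
    then obtain b where "b \<noteq> 0" "\<And>y. y \<in> span (range (A x)) \<Longrightarrow> orthogonal b y"
      using orthogonal_to_subspace_exists by blast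
    then show ?thesis
      by (intro exI[of _ "b /\<^sub>R norm b"]) (auto simp: orthogonal_def span_base)
  qed
  then obtain a where a: "\<And>x. x \<in> S \<Longrightarrow> norm (a x) = 1"
    and orth: "\<And>x v. x \<in> S \<Longrightarrow> a x \<bullet> A x v = 0"
    by metis
  have "negligible (F ` (S \<inter> ball 0 (real n)))" for n
    unfolding negligible_outer_le
  proof (intro allI impI)
    fix e :: real assume e: "0 < e"
    \<comment> \<open>The factor 2 and the radius \<open>4 * (M * r)\<close> come from
      \<open>measure_slab_le\<close>: a slab has at most \<open>\<eta> * c\<close> times the volume
      of the ball of radius \<open>r\<close>. The \<open>+ 1\<close> in \<open>\<eta>\<close> avoids
      division by zero, as \<open>B\<close> is 0 for \<open>n = 0\<close>.\<close>
    define c where "c = 2 * (4 * M) ^ DIM('a)"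
    define B where "B = measure lebesgue (ball (0::'a) (real n))"
    define \<eta> where "\<eta> = min 1 (e / (c * B + 1))"
    have c: "0 < c" and B: "0 \<le> B"
      using M by (auto simp: c_def B_def)
    have \<eta>: "0 < \<eta>" "\<eta> \<le> 1"
      using e c B by (auto simp: \<eta>_def intro!: divide_pos_pos add_nonneg_pos)
    have "\<eta> * (c * B) \<le> e / (c * B + 1) * (c * B)"
      using c B by (intro mult_right_mono) (auto simp: \<eta>_def)
    also have "\<dots> \<le> e"
    proof -
      have "e / (X + 1) * X \<le> e" if "0 \<le> X" for X
        using e that by (simp add: pos_divide_le_eq)
      then show ?thesis using c B by simp
    qed
    finally have \<eta>e: "\<eta> * c * B \<le> e" by (simp add: mult.assoc)
    \<comment> \<open>T x r is a slab about F x, orthogonal to a normal of the range of A x and thin compared with r;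
      to first order, F maps cball x r into it.\<close>
    define T where "T x r = (+) (F x) ` {y \<in> cball 0 (M * r). \<bar>a x \<bullet> y\<bar> \<le> \<eta> * (M * r)}" for x r
    have Tm: "T x r \<in> lmeasurable" for x r
    proof -
      have "closed {y. \<bar>a x \<bullet> y\<bar> \<le> \<eta> * (M * r)}"
        by (intro closed_Collect_le continuous_intros)
      then have "compact {y \<in> cball 0 (M * r). \<bar>a x \<bullet> y\<bar> \<le> \<eta> * (M * r)}"
        unfolding Collect_conj_eq by (metis Collect_mem_eq compact_Int_closed compact_cball)
      then show ?thesis
        unfolding T_def by (intro measurable_translation lmeasurable_compact)
    qed
    have Tle: "measure lebesgue (T x r) \<le> \<eta> * c * measure lebesgue (cball x r)"
      if "x \<in> S" "0 < r" for x r
    proof -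
      have "measure lebesgue (T x r) \<le> 2 * \<eta> * measure lebesgue (cball (0::'a) (4 * (M * r)))"
        unfolding T_def measure_translation using that M \<eta> a by (intro measure_slab_le) auto
      also have "\<dots> = \<eta> * c * measure lebesgue (cball x r)"
        using that M by (simp add: c_def content_cball power_mult_distrib)
      finally show ?thesis .
    qed
    have "\<exists>d>0. ball x d \<subseteq> ball 0 (real n) \<and> (\<forall>r. 0 < r \<and> r < d \<longrightarrow> F ` cball x r \<subseteq> T x r)"
      if x: "x \<in> S \<inter> ball 0 (real n)" for x
    proof -
      have "\<eta> * M > 0" using \<eta> M by simp
      then obtain d where d: "d > 0"
        "\<And>y. norm (y - x) < d \<Longrightarrow> norm (F y - F x - A x (y - x)) \<le> \<eta> * M * norm (y - x)"
        using der[of x] x unfolding has_derivative_at_alt by blast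
      obtain d' where d': "d' > 0" "ball x d' \<subseteq> ball 0 (real n)"
        using x by (metis IntD2 open_ball openE)
      have "F ` cball x r \<subseteq> T x r" if r: "0 < r" "r < d" for r
      proof clarify
        fix y assume y: "y \<in> cball x r"
        then have yr: "norm (y - x) \<le> r"
          by (simp add: dist_norm norm_minus_commute)
        have "norm (F y - F x) \<le> M * r"
          using lipM[of y x] yr M by (meson less_imp_le mult_left_mono order_trans)
        moreover have "\<bar>a x \<bullet> (F y - F x)\<bar> \<le> \<eta> * (M * r)"
        proof -
          have "\<bar>a x \<bullet> (F y - F x)\<bar> = \<bar>a x \<bullet> (F y - F x - A x (y - x))\<bar>"
            using orth[of x] x by (simp add: inner_diff_right)
          also have "\<dots> \<le> norm (F y - F x - A x (y - x))"
            using Cauchy_Schwarz_ineq2[of "a x"] a[of x] x by (metis IntD1 mult_1)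
          also have "\<dots> \<le> \<eta> * M * norm (y - x)"
            using d yr r by auto
          also have "\<dots> \<le> \<eta> * M * r"
            using yr \<open>\<eta> * M > 0\<close> by (intro mult_left_mono) auto
          finally show ?thesis by (simp add: mult.assoc)
        qed
        ultimately show "F y \<in> T x r"
          unfolding T_def by (intro image_eqI[of _ _ "F y - F x"]) auto
      qed
      then show ?thesis
        using d d' by (intro exI[of _ "min d d'"]) auto
    qed
    then obtain d where d0: "\<And>x. x \<in> S \<inter> ball 0 (real n) \<Longrightarrow> 0 < d x"
      and dball: "\<And>x. x \<in> S \<inter> ball 0 (real n) \<Longrightarrow> ball x (d x) \<subseteq> ball 0 (real n)"
      and dT: "\<And>x r. x \<in> S \<inter> ball 0 (real n) \<Longrightarrow> 0 < r \<Longrightarrow> r < d x \<Longrightarrow> F ` cball x r \<subseteq> T x r"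
      by metis
    define K where "K = {(x, r). x \<in> S \<inter> ball 0 (real n) \<and> 0 < r \<and> r < d x}"
    have K_pos: "0 < snd i" if "i \<in> K" for i
      using that by (auto simp: K_def)
    have K_fine: "\<exists>i. i \<in> K \<and> x \<in> cball (fst i) (snd i) \<and> snd i < d'"
      if x: "x \<in> S \<inter> ball 0 (real n)" and d': "0 < d'" for x d'
    proof (intro exI conjI)
      show "(x, min d' (d x) / 2) \<in> K"
        using x d' d0[OF x] by (simp add: K_def min_def)
    qed (use d' d0[OF x] in auto)
    \<comment> \<open>\<open>K\<close> consists of centre-radius pairs for which the slab inclusion
      holds. It contains arbitrarily small balls around each point of the set, as Vitali's theorem
      requires.\<close>
    obtain C where C: "countable C" "C \<subseteq> K"
      and disj: "pairwise (\<lambda>i j. disjnt (cball (fst i) (snd i)) (cball (fst j) (snd j))) C"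
      and neg: "negligible (S \<inter> ball 0 (real n) - (\<Union>i\<in>C. cball (fst i) (snd i)))"
      by (rule Vitali_covering_theorem_cballs[OF K_pos K_fine])
    define W where "W = (\<Union>i\<in>C. T (fst i) (snd i))"
    \<comment> \<open>The balls are disjoint and contained in the ball of volume \<open>B\<close>,
      so the slab volumes sum to at most \<open>\<eta> * c * B\<close>.\<close>
    have fin: "(\<Sum>i\<in>I. measure lebesgue (T (fst i) (snd i))) \<le> e"
      if I: "I \<subseteq> C" "finite I" for I
    proof -
      have "(\<Sum>i\<in>I. measure lebesgue (T (fst i) (snd i)))
              \<le> (\<Sum>i\<in>I. \<eta> * c * measure lebesgue (cball (fst i) (snd i)))"
        using I C(2) by (intro sum_mono Tle) (auto simp: K_def)
      also have "\<dots> = \<eta> * c * measure lebesgue (\<Union>i\<in>I. cball (fst i) (snd i))"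
        using I pairwise_subset[OF disj]
        by (subst measure_UNION') (auto simp: sum_distrib_left)
      also have "\<dots> \<le> \<eta> * c * B"
        unfolding B_def
      proof (intro mult_left_mono measure_mono_fmeasurable)
        show "(\<Union>i\<in>I. cball (fst i) (snd i)) \<subseteq> ball 0 (real n)"
        proof clarify
          fix x r y assume "(x, r) \<in> I" "y \<in> cball (fst (x, r)) (snd (x, r))"
          then have "x \<in> S \<inter> ball 0 (real n)" "y \<in> ball x (d x)"
            using I C(2) by (auto simp: K_def)
          then show "y \<in> ball 0 (real n)"
            using dball by blast
        qed
      qed (use I \<eta> c in \<open>auto intro!: sets.finite_UN\<close>)
      finally show ?thesis using \<eta>e by linarith
    qed
    have W: "W \<in> lmeasurable" "measure lebesgue W \<le> e"
    proof -
      have le: "measure lebesgue (\<Union>i\<in>I. T (fst i) (snd i)) \<le> e" if I: "I \<subseteq> C" "finite I" for I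
        using measure_UNION_le[OF I(2), of "\<lambda>i. T (fst i) (snd i)" lebesgue] fin[OF I] Tm
        by (meson fmeasurableD order_trans)
      show "W \<in> lmeasurable" "measure lebesgue W \<le> e"
        unfolding W_def by (rule fmeasurable_UN_bound measure_UN_bound, rule C(1), rule Tm, erule (1) le)+
    qed
    define N where "N = F ` (S \<inter> ball 0 (real n) - (\<Union>i\<in>C. cball (fst i) (snd i)))"
    have N: "negligible N"
      unfolding N_def by (rule negligible_lipschitz_image[OF lip neg])
    show "\<exists>T. F ` (S \<inter> ball 0 (real n)) \<subseteq> T \<and> T \<in> lmeasurable \<and> measure lebesgue T \<le> e"
    proof (intro exI conjI)
      show "F ` (S \<inter> ball 0 (real n)) \<subseteq> W \<union> N"
      proof clarify
        fix x assume x: "x \<in> S" "x \<in> ball 0 (real n)" "F x \<notin> N"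
        then obtain i where i: "i \<in> C" "x \<in> cball (fst i) (snd i)"
          unfolding N_def by blast
        then have "F ` cball (fst i) (snd i) \<subseteq> T (fst i) (snd i)"
          using C(2) by (intro dT) (auto simp: K_def)
        then show "F x \<in> W"
          using i unfolding W_def by blast
      qed
      show "W \<union> N \<in> lmeasurable"
        using W N by (simp add: fmeasurable.Un negligible_imp_measurable)
      show "measure lebesgue (W \<union> N) \<le> e"
        using W N by (simp add: measure_Un_null_set negligible_iff_null_sets fmeasurableD)
    qed
  qed
  then have "negligible (\<Union>n. F ` (S \<inter> ball 0 (real n)))"
    by (intro negligible_Union_nat)
  moreover have "F ` S \<subseteq> (\<Union>n. F ` (S \<inter> ball 0 (real n)))"
    using reals_Archimedean2 by fastforce
  ultimately show ?thesis
    by (rule negligible_subset)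
qed

section \<open>Lipschitz extension\<close>

lemma lipschitz_extension_real:
  fixes g :: "'a::metric_space \<Rightarrow> real"
  assumes lip: "L-lipschitz_on D g"
  obtains F where "L-lipschitz_on UNIV F" "\<And>d. d \<in> D \<Longrightarrow> F d = g d"
proof (cases "D = {}")
  case True
  then show ?thesis
    using that[of "\<lambda>_. 0"] lipschitz_on_nonneg[OF lip] by (auto simp: lipschitz_on_def)
next
  case False
  have L: "0 \<le> L" using lip by (rule lipschitz_on_nonneg)
  \<comment> \<open>McShane's formula\<close>
  define F where "F z = (INF d\<in>D. g d + L * dist z d)" for z
  \<comment> \<open>This estimate bounds the infimum from below and, at \<open>z = c\<close>, shows
    that the extension does not fall below \<open>g\<close>.\<close>
  have g_le: "g c - L * dist z c \<le> g d + L * dist z d" if "c \<in> D" "d \<in> D" for c d z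
  proof -
    have "g c - g d \<le> L * dist c d"
      using lipschitz_onD[OF lip that] by (simp add: dist_real_def)
    also have "\<dots> \<le> L * (dist z c + dist z d)"
      using L by (intro mult_left_mono) (metis dist_commute dist_triangle)
    finally show ?thesis by (simp add: algebra_simps)
  qed
  have bdd: "bdd_below ((\<lambda>d. g d + L * dist z d) ` D)" for z
  proof -
    obtain c where "c \<in> D" using False by blast
    then show ?thesis
      by (intro bdd_belowI2[where m = "g c - L * dist z c"]) (rule g_le)
  qed
  have F_le: "F z \<le> F w + L * dist z w" for z w
  proof -
    have "F z - L * dist z w \<le> g d + L * dist w d" if "d \<in> D" for d
    proof -
      have "F z \<le> g d + L * dist z d"
        unfolding F_def using bdd that by (rule cINF_lower)
      also have "L * dist z d \<le> L * (dist z w + dist w d)"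
        using L by (intro mult_left_mono dist_triangle)
      finally show ?thesis by (simp add: algebra_simps)
    qed
    then have "F z - L * dist z w \<le> F w"
      unfolding F_def[of w] using False by (intro cINF_greatest)
    then show ?thesis by simp
  qed
  have "L-lipschitz_on UNIV F"
  proof (rule lipschitz_onI)
    show "dist (F z) (F w) \<le> L * dist z w" for z w
      using F_le[of z w] F_le[of w z] by (simp add: dist_real_def dist_commute abs_le_iff)
  qed (rule L)
  moreover have "F d = g d" if d: "d \<in> D" for d
  proof (rule antisym)
    show "F d \<le> g d"
      unfolding F_def using cINF_lower[OF bdd d, of d] by simp
    show "g d \<le> F d"
      unfolding F_def using False g_le[OF d, of _ d] by (intro cINF_greatest) auto
  qed
  ultimately show ?thesis by (rule that)
qed

text \<open>Each coordinate is extended separately. The Lipschitz constant grows by at most the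
  factor \<open>DIM('b)\<close>, hence the unspecified \<open>C\<close>.\<close>

lemma lipschitz_extension:
  fixes g :: "'a::metric_space \<Rightarrow> 'b::euclidean_space"
  assumes lip: "L-lipschitz_on D g"
  obtains F C where "C-lipschitz_on UNIV F" "\<And>d. d \<in> D \<Longrightarrow> F d = g d"
proof -
  have L: "0 \<le> L" using lip by (rule lipschitz_on_nonneg)
  have "\<exists>F. L-lipschitz_on UNIV F \<and> (\<forall>d\<in>D. F d = g d \<bullet> b)" if b: "b \<in> Basis" for b
  proof -
    have "L-lipschitz_on D (\<lambda>x. g x \<bullet> b)"
    proof (rule lipschitz_onI)
      show "dist (g x \<bullet> b) (g y \<bullet> b) \<le> L * dist x y" if "x \<in> D" "y \<in> D" for x y
        using lipschitz_onD[OF lip that] Basis_le_norm[OF b, of "g x - g y"]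
        by (simp add: dist_real_def dist_norm inner_diff_left)
    qed (rule L)
    then show ?thesis
    proof (rule lipschitz_extension_real)
      fix F assume "L-lipschitz_on UNIV F" "\<And>d. d \<in> D \<Longrightarrow> F d = g d \<bullet> b"
      then show ?thesis by blast
    qed
  qed
  then have "\<forall>b\<in>Basis. \<exists>F. L-lipschitz_on UNIV F \<and> (\<forall>d\<in>D. F d = g d \<bullet> b)"
    by blast
  from bchoice[OF this] obtain F
    where "\<forall>b\<in>Basis. L-lipschitz_on UNIV (F b) \<and> (\<forall>d\<in>D. F b d = g d \<bullet> b)" ..
  then have F: "\<And>b. b \<in> Basis \<Longrightarrow> L-lipschitz_on UNIV (F b)"
    "\<And>b d. b \<in> Basis \<Longrightarrow> d \<in> D \<Longrightarrow> F b d = g d \<bullet> b"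
    by simp_all
  define G where "G x = (\<Sum>b\<in>Basis. F b x *\<^sub>R b)" for x
  have G_inner: "G x \<bullet> b = F b x" if "b \<in> Basis" for b x
    using that by (simp add: G_def inner_sum_left inner_Basis if_distrib cong: if_cong)
  have "(real DIM('b) * L)-lipschitz_on UNIV G"
  proof (rule lipschitz_onI)
    fix x y
    have "dist (G x) (G y) \<le> (\<Sum>b\<in>Basis. \<bar>(G x - G y) \<bullet> b\<bar>)"
      unfolding dist_norm by (rule norm_le_l1)
    also have "\<dots> \<le> (\<Sum>b\<in>(Basis::'b set). L * dist x y)"
    proof (rule sum_mono)
      fix b :: 'b assume b: "b \<in> Basis"
      show "\<bar>(G x - G y) \<bullet> b\<bar> \<le> L * dist x y"
        using lipschitz_onD[OF F(1)[OF b], of x y] by (simp add: inner_diff_left G_inner[OF b] dist_real_def)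
    qed
    finally show "dist (G x) (G y) \<le> real DIM('b) * L * dist x y"
      by simp
  qed (use L in simp)
  moreover have "G d = g d" if "d \<in> D" for d
    by (rule euclidean_eqI) (simp add: G_inner F(2)[OF _ that])
  ultimately show ?thesis by (rule that)
qed

section \<open>Subgradients of convex functions\<close>

definition subgradient :: "('a::real_inner \<Rightarrow> real) \<Rightarrow> 'a \<Rightarrow> 'a \<Rightarrow> bool" where
  "subgradient \<phi> x p \<longleftrightarrow> (\<forall>y. \<phi> x + p \<bullet> (y - x) \<le> \<phi> y)"

lemma subgradientD: "subgradient \<phi> x p \<Longrightarrow> \<phi> x + p \<bullet> (y - x) \<le> \<phi> y"
  by (simp add: subgradient_def)

lemma subgradient_convex_combination:
  assumes "subgradient \<phi> x p" "subgradient \<phi> x q" "0 \<le> t" "t \<le> 1"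
  shows "subgradient \<phi> x (p + t *\<^sub>R (q - p))"
  unfolding subgradient_def
proof
  fix y
  define P Q where "P = p \<bullet> (y - x)" and "Q = q \<bullet> (y - x)"
  have "(1 - t) * (\<phi> x + P) + t * (\<phi> x + Q) \<le> (1 - t) * \<phi> y + t * \<phi> y"
    unfolding P_def Q_def using assms by (intro add_mono mult_left_mono subgradientD) auto
  then have "\<phi> x + (P + t * (Q - P)) \<le> \<phi> y"
    by (simp add: algebra_simps)
  then show "\<phi> x + (p + t *\<^sub>R (q - p)) \<bullet> (y - x) \<le> \<phi> y"
    unfolding P_def Q_def by (simp only: inner_add_left inner_scaleR_left inner_diff_left)
qed

text \<open>A hyperplane separating the strict epigraph from the point of the graph over
  \<open>x\<close> is not vertical because \<phi> is finite everywhere; its slope is the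
  subgradient.\<close>

lemma ex_subgradient:
  fixes \<phi> :: "'a::euclidean_space \<Rightarrow> real"
  assumes conv: "convex_on UNIV \<phi>"
  shows "\<exists>p. subgradient \<phi> x p"
proof -
  \<comment> \<open>The strict epigraph, translated so that the graph point over \<open>x\<close>
    becomes the origin.\<close>
  define S where "S = {(v, s). \<phi> (x + v) - \<phi> x < s}"
  have "convex S"
    unfolding convex_alt
  proof (intro ballI allI impI)
    fix a b and t :: real
    assume ab: "a \<in> S" "b \<in> S" and t: "0 \<le> t \<and> t \<le> 1"
    obtain v s w r where [simp]: "a = (v, s)" "b = (w, r)"
      by (cases a, cases b) blast
    have "\<phi> (x + ((1 - t) *\<^sub>R v + t *\<^sub>R w)) = \<phi> ((1 - t) *\<^sub>R (x + v) + t *\<^sub>R (x + w))"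
      by (simp add: algebra_simps)
    also have "\<dots> \<le> (1 - t) * \<phi> (x + v) + t * \<phi> (x + w)"
      using t by (intro convex_onD[OF conv]) auto
    finally have "\<phi> (x + ((1 - t) *\<^sub>R v + t *\<^sub>R w)) - \<phi> x \<le> (1 - t) * (\<phi> (x + v) - \<phi> x) + t * (\<phi> (x + w) - \<phi> x)"
      by (simp add: algebra_simps)
    also have "\<dots> < (1 - t) * s + t * r"
    proof (cases "t = 0")
      case False
      then have "t * (\<phi> (x + w) - \<phi> x) < t * r"
        using ab t by (simp add: S_def)
      moreover have "(1 - t) * (\<phi> (x + v) - \<phi> x) \<le> (1 - t) * s"
        using ab t by (intro mult_left_mono) (auto simp: S_def)
      ultimately show ?thesis by linarith
    qed (use ab in \<open>simp add: S_def\<close>)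
    finally show "(1 - t) *\<^sub>R a + t *\<^sub>R b \<in> S"
      by (simp add: S_def)
  qed
  moreover have "0 \<notin> S"
    by (simp add: S_def zero_prod_def)
  ultimately obtain ac where ac: "ac \<noteq> 0" and sep': "\<And>z. z \<in> S \<Longrightarrow> 0 \<le> ac \<bullet> z"
    using separating_hyperplane_set_0[of S] by blast
  define a c where "a = fst ac" and "c = snd ac"
  have sep: "0 \<le> a \<bullet> v + c * s" if "(v, s) \<in> S" for v s
    using sep'[OF that] by (simp add: a_def c_def inner_prod_def)
  have "0 \<le> c"
    using sep[of 0 1] by (simp add: S_def)
  \<comment> \<open>A vertical hyperplane is excluded by testing with a point of \<open>S\<close>
    over \<open>- a\<close>: it would force \<open>a = 0\<close>.\<close>
  moreover have "c \<noteq> 0"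
  proof
    assume "c = 0"
    moreover have "0 \<le> a \<bullet> (- a) + c * (\<phi> (x - a) - \<phi> x + 1)"
      by (rule sep) (simp add: S_def)
    ultimately have "a \<bullet> a = 0"
      using inner_ge_zero[of a] by simp
    then show False using ac \<open>c = 0\<close> by (simp add: a_def c_def prod_eq_iff)
  qed
  ultimately have c: "0 < c" by simp
  have "subgradient \<phi> x (- a /\<^sub>R c)"
    unfolding subgradient_def
  proof
    fix y
    have "(- a /\<^sub>R c) \<bullet> (y - x) \<le> \<phi> y - \<phi> x"
    proof (rule dense_ge)
      fix s assume "\<phi> y - \<phi> x < s"
      then have "0 \<le> a \<bullet> (y - x) + c * s"
        by (intro sep) (simp add: S_def)
      then show "(- a /\<^sub>R c) \<bullet> (y - x) \<le> s"
        using c by (simp add: field_simps)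
    qed
    then show "\<phi> x + (- a /\<^sub>R c) \<bullet> (y - x) \<le> \<phi> y"
      by simp
  qed
  then show ?thesis by blast
qed

text \<open>Subgradients are bounded near \<open>x\<close>, and a limit of subgradients at points
  tending to \<open>x\<close> is a subgradient at \<open>x\<close>. Uniqueness there identifies
  every such limit with \<open>q x\<close>.\<close>

lemma isCont_subgradient_selection:
  fixes \<phi> :: "'a::euclidean_space \<Rightarrow> real"
  assumes conv: "convex_on UNIV \<phi>"
    and q: "\<And>x. subgradient \<phi> x (q x)"
    and uniq: "\<And>p. subgradient \<phi> x p \<Longrightarrow> p = q x"
  shows "isCont q x"
proof (rule ccontr)
  assume "\<not> isCont q x"
  then obtain e where e: "0 < e" and far: "\<And>d. 0 < d \<Longrightarrow> \<exists>y. dist y x < d \<and> e \<le> dist (q y) (q x)"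
    unfolding continuous_at_eps_delta by (meson not_le)
  then have "\<forall>n. \<exists>y. dist y x < 1 / real (Suc n) \<and> e \<le> dist (q y) (q x)"
    by simp
  then obtain X where X: "\<And>n. dist (X n) x < 1 / real (Suc n)" "\<And>n. e \<le> dist (q (X n)) (q x)"
    by metis
  have Xx: "X \<longlonglongrightarrow> x"
  proof (rule tendstoI)
    fix r :: real assume r: "0 < r"
    have "(\<lambda>n. 1 / real (Suc n)) \<longlonglongrightarrow> 0"
      using LIMSEQ_inverse_real_of_nat by (simp add: inverse_eq_divide)
    from order_tendstoD(2)[OF this r] show "\<forall>\<^sub>F n in sequentially. dist (X n) x < r"
      by eventually_elim (use X(1) in \<open>auto intro: order_less_trans\<close>)
  qed
  have cont: "continuous_on UNIV \<phi>"
    using conv by (intro convex_on_continuous) auto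
  then have "bounded (\<phi> ` cball x 2)"
    by (intro compact_imp_bounded compact_continuous_image) (auto intro: continuous_on_subset)
  then obtain M where "\<forall>s\<in>\<phi> ` cball x 2. norm s \<le> M"
    unfolding bounded_iff by blast
  then have M: "\<bar>\<phi> y\<bar> \<le> M" if "y \<in> cball x 2" for y
    using that by simp
  \<comment> \<open>A unit step from \<open>y\<close> in the direction of \<open>q y\<close> raises
    \<phi> by at least \<open>norm (q y)\<close> and stays within distance 2 of \<open>x\<close>,
    where \<open>M\<close> bounds \<phi>.\<close>
  have q_le: "norm (q y) \<le> 2 * M" if y: "dist y x \<le> 1" for y
  proof (cases "q y = 0")
    case False
    define u where "u = q y /\<^sub>R norm (q y)"
    have u: "norm u = 1" "q y \<bullet> u = norm (q y)"
      using False by (auto simp: u_def dot_square_norm power2_eq_square)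
    have "dist x (y + u) \<le> 2"
      using y u norm_triangle_ineq[of "y - x" u] by (simp add: dist_norm norm_minus_commute algebra_simps)
    then show ?thesis
      using subgradientD[OF q[of y], of "y + u"] u y M[of y] M[of "y + u"] by (simp add: dist_commute)
  qed (use M[of x] in simp)
  have "norm (q (X n)) \<le> 2 * M" for n
    using X(1)[of n] by (intro q_le) (smt (verit) divide_le_eq_1 of_nat_Suc of_nat_0_le_iff)
  then have "bounded (range (\<lambda>n. q (X n)))"
    by (auto simp: bounded_iff)
  then obtain l r where r: "strict_mono r" and l: "((\<lambda>n. q (X n)) \<circ> r) \<longlonglongrightarrow> l"
    using bounded_imp_convergent_subsequence by blast
  have Xr: "(\<lambda>n. X (r n)) \<longlonglongrightarrow> x"
    using LIMSEQ_subseq_LIMSEQ[OF Xx r] by (simp add: o_def)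
  have "subgradient \<phi> x l"
    unfolding subgradient_def
  proof
    fix y
    have "(\<lambda>n. \<phi> (X (r n)) + q (X (r n)) \<bullet> (y - X (r n))) \<longlonglongrightarrow> \<phi> x + l \<bullet> (y - x)"
      using l cont Xr by (intro tendsto_intros continuous_on_tendsto_compose[OF cont]) (auto simp: o_def)
    then show "\<phi> x + l \<bullet> (y - x) \<le> \<phi> y"
      by (rule tendsto_upperbound) (auto intro!: always_eventually subgradientD q)
  qed
  then have "l = q x" by (rule uniq)
  then have "(\<lambda>n. dist (q (X (r n))) (q x)) \<longlonglongrightarrow> 0"
    using l tendsto_dist_iff[of "\<lambda>n. q (X (r n))" "q x"] by (simp add: o_def)
  then have "e \<le> 0"
    by (rule tendsto_lowerbound) (auto simp: X(2))
  then show False using e by simp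
qed

section \<open>Minty's parametrization and differentiability\<close>

lemma AE_differentiable_if_subgradient_strongly_monotone:
  fixes \<phi> :: "'a::euclidean_space \<Rightarrow> real" and \<gamma> :: "'a \<Rightarrow> 'b::euclidean_space"
  assumes conv: "convex_on UNIV \<phi>" and c: "0 < c"
    and mono: "\<And>x y p q. subgradient \<phi> x p \<Longrightarrow> subgradient \<phi> y q \<Longrightarrow>
      c * (norm (\<gamma> x - \<gamma> y))\<^sup>2 \<le> (p - q) \<bullet> (x - y)"
  shows "AE x in lebesgue. \<gamma> differentiable (at x)"
proof -
  obtain q where q: "\<And>x. subgradient \<phi> x (q x)"
    using ex_subgradient[OF conv] by metis
  \<comment> \<open>On \<open>D\<close> the choice is forced: \<open>key1\<close> with
    \<open>w = z\<close> shows that \<open>z\<close> determines \<open>x\<close>.\<close>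
  define X where "X z = (SOME x. subgradient \<phi> x (z - x))" for z
  define D where "D = {z. \<exists>x. subgradient \<phi> x (z - x)}"
  have X: "subgradient \<phi> (X z) (z - X z)" if "z \<in> D" for z
    unfolding X_def using that by (auto simp: D_def intro: someI)
  \<comment> \<open>Minty's parametrization: x and \<gamma> x are Lipschitz functions of z = x + p with p a subgradient at x.\<close>
  have key: "(norm (x - y))\<^sup>2 + 2 * (c * (norm (\<gamma> x - \<gamma> y))\<^sup>2) \<le> (norm (z - w))\<^sup>2"
    if "subgradient \<phi> x (z - x)" "subgradient \<phi> y (w - y)" for x y z w
  proof -
    define p where "p = (z - x) - (w - y)"
    have "(norm (z - w))\<^sup>2 = (norm ((x - y) + p))\<^sup>2"
      by (simp add: p_def)
    also have "\<dots> = (norm (x - y))\<^sup>2 + (norm p)\<^sup>2 + 2 * (p \<bullet> (x - y))"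
      by (simp add: power2_norm_eq_inner inner_add_left inner_add_right inner_commute)
    finally show ?thesis
      using mono[OF that] by (simp add: p_def) (smt (verit) zero_le_power2)
  qed
  have key1: "norm (x - y) \<le> norm (z - w)"
    if "subgradient \<phi> x (z - x)" "subgradient \<phi> y (w - y)" for x y z w
  proof (rule power2_le_imp_le)
    show "(norm (x - y))\<^sup>2 \<le> (norm (z - w))\<^sup>2"
      using key[OF that] c by (smt (verit) mult_nonneg_nonneg zero_le_power2)
  qed simp
  have key2: "norm (\<gamma> x - \<gamma> y) \<le> (1 / sqrt (2 * c)) * norm (z - w)"
    if "subgradient \<phi> x (z - x)" "subgradient \<phi> y (w - y)" for x y z w
  proof (rule power2_le_imp_le)
    have "2 * c * (norm (\<gamma> x - \<gamma> y))\<^sup>2 \<le> (norm (z - w))\<^sup>2"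
      unfolding mult.assoc using key[OF that] zero_le_power2[of "norm (x - y)"] by linarith
    then show "(norm (\<gamma> x - \<gamma> y))\<^sup>2 \<le> ((1 / sqrt (2 * c)) * norm (z - w))\<^sup>2"
      using c by (simp add: power_mult_distrib power_divide field_simps)
  qed (use c in simp)
  have "1-lipschitz_on D X"
    using key1[OF X X] by (intro lipschitz_onI) (auto simp: dist_norm)
  \<comment> \<open>The extension from \<open>D\<close> to the whole space makes Rademacher's
    theorem and the lemma on critical values applicable.\<close>
  then obtain P C where P: "C-lipschitz_on UNIV P" "\<And>z. z \<in> D \<Longrightarrow> P z = X z"
    using lipschitz_extension by metis
  have "(1 / sqrt (2 * c))-lipschitz_on D (\<lambda>z. \<gamma> (X z))"
    using key2[OF X X] c by (intro lipschitz_onI) (auto simp: dist_norm)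
  then obtain G C' where G: "C'-lipschitz_on UNIV G" "\<And>z. z \<in> D \<Longrightarrow> G z = \<gamma> (X z)"
    using lipschitz_extension by metis
  have PG: "P (x + p) = x" "G (x + p) = \<gamma> x" if p: "subgradient \<phi> x p" for x p
  proof -
    have z: "x + p \<in> D"
      using p by (auto simp: D_def intro!: exI[of _ x])
    have "X (x + p) = x"
      using key1[OF X[OF z], of x "x + p"] p by simp
    then show "P (x + p) = x" "G (x + p) = \<gamma> x"
      using P(2)[OF z] G(2)[OF z] by simp_all
  qed
  define N where "N = {z. \<not> P differentiable at z} \<union> {z. \<not> G differentiable at z}"
  define S where "S = {z. P differentiable at z \<and> \<not> inj (frechet_derivative P (at z))}"
  have "negligible (P ` N)"
    unfolding N_def using P(1) G(1)
    by (intro negligible_lipschitz_image negligible_Un negligible_not_differentiable_lipschitz)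
  moreover have "negligible (P ` S)"
    using P(1)
  proof (rule negligible_critical_values)
    show "(P has_derivative frechet_derivative P (at z)) (at z)" if "z \<in> S" for z
      using that by (simp add: S_def frechet_derivative_works)
  qed (simp add: S_def)
  ultimately have "negligible (P ` N \<union> P ` S)"
    by (rule negligible_Un)
  then have "AE x in lebesgue. x \<notin> P ` N \<union> P ` S"
    unfolding negligible_iff_null_sets by (rule AE_not_in)
  then show ?thesis
  proof eventually_elim
    fix x assume x: "x \<notin> P ` N \<union> P ` S"
    define z where "z = x + q x"
    have Pz: "P z = x"
      using PG(1)[OF q] by (simp add: z_def)
    then have "z \<notin> N" "z \<notin> S"
      using x by auto
    then have G': "G differentiable at z"
      and P': "P differentiable at z" and inj: "inj (frechet_derivative P (at z))"
      by (auto simp: N_def S_def)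
    define A where "A = frechet_derivative P (at z)"
    have A: "(P has_derivative A) (at z)"
      using P' by (simp add: A_def frechet_derivative_works)
    then have linA: "linear A"
      by (rule has_derivative_linear)
    obtain A' where A': "linear A'" "A' \<circ> A = id"
      using linear_injective_left_inverse[OF linA] inj by (auto simp: A_def)
    \<comment> \<open>P is constant on x plus the convex set of subgradients at x, and its derivative at z is injective.\<close>
    have uniq: "p = q x" if p: "subgradient \<phi> x p" for p
    proof -
      define d where "d = p - q x"
      have "((\<lambda>t. P (z + t *\<^sub>R d)) has_vector_derivative A d) (at 0 within {0..1})"
      proof -
        have "((\<lambda>t. z + t *\<^sub>R d) has_derivative (\<lambda>t. t *\<^sub>R d)) (at 0 within {0..1})"
          by (auto intro!: derivative_eq_intros)
        then have "((\<lambda>t. P (z + t *\<^sub>R d)) has_derivative (\<lambda>t. A (t *\<^sub>R d))) (at 0 within {0..1})"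
          by (rule has_derivative_compose) (simp add: A)
        then show ?thesis
          by (simp add: has_vector_derivative_def linear_scale[OF linA])
      qed
      moreover have "((\<lambda>t. P (z + t *\<^sub>R d)) has_vector_derivative 0) (at 0 within {0..1})"
      proof (rule has_vector_derivative_transform)
        show "P (z + t *\<^sub>R d) = x" if "t \<in> {0..1}" for t
          using PG(1)[OF subgradient_convex_combination[OF q p, of t]] that
          by (simp add: z_def d_def add.assoc)
      qed auto
      ultimately have "A d = 0"
        by (intro vector_derivative_unique_within_closed_interval[of 0 1 0 "\<lambda>t. P (z + t *\<^sub>R d)"]) auto
      then have "d = 0"
        using inj linA by (metis A_def injD linear_0)
      then show ?thesis by (simp add: d_def)
    qed
    have "isCont (\<lambda>x. x + q x) x"
      using isCont_subgradient_selection[OF conv q uniq] by (intro continuous_intros)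
    \<comment> \<open>The map \<open>x + q x\<close> is a right inverse of \<open>P\<close>. Its
      continuity at \<open>x\<close>, together with the left inverse \<open>A'\<close> of the
      derivative of \<open>P\<close>, gives its derivative there.\<close>
    then have "((\<lambda>x. x + q x) has_derivative A') (at x)"
      using A A' PG(1)[OF q]
      by (intro has_derivative_inverse_basic[of P A _ x A' UNIV])
        (auto simp: z_def linear_conv_bounded_linear)
    then have "(G \<circ> (\<lambda>x. x + q x)) differentiable at x"
      using G' by (intro differentiable_chain_at) (auto simp: z_def intro: differentiableI)
    moreover have "G \<circ> (\<lambda>x. x + q x) = \<gamma>"
      using PG(2)[OF q] by (simp add: fun_eq_iff)
    ultimately show "\<gamma> differentiable at x"
      by simp
  qed
qed

section \<open>The minimizer of a partially strongly convex function\<close>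

theorem theorem1p1:
  fixes f :: "'a::euclidean_space \<Rightarrow> 'b::euclidean_space \<Rightarrow> real"
    and \<gamma> :: "'a \<Rightarrow> 'b"
    and \<kappa> \<sigma> :: real
  assumes kappa: "\<kappa> \<ge> 0" and sigma: "\<sigma> > 0"
    and conv: "convex_on UNIV (\<lambda>(x, y). f x y + \<kappa> / 2 * (norm x)\<^sup>2 - \<sigma> / 2 * (norm y)\<^sup>2)"
    and argmin: "\<And>x y. (\<forall>z. f x y \<le> f x z) \<longleftrightarrow> y = \<gamma> x"
  shows "AE x in lebesgue. \<gamma> differentiable (at x)"
proof -
  define \<phi> where "\<phi> x = f x (\<gamma> x) + \<kappa> / 2 * (norm x)\<^sup>2" for x
  have \<phi>_le: "\<phi> x \<le> f x y + \<kappa> / 2 * (norm x)\<^sup>2" for x y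
    using argmin[of x "\<gamma> x"] by (simp add: \<phi>_def)
  \<comment> \<open>Joint convexity is applied between \<open>(x, \<gamma> x)\<close> and
    \<open>(y, \<gamma> y)\<close>. The extra term is the defect of the squared norm along the
    segment from \<open>\<gamma> x\<close> to \<open>\<gamma> y\<close>.\<close>
  have \<phi>_strong: "\<phi> ((1 - t) *\<^sub>R x + t *\<^sub>R y)
      \<le> (1 - t) * \<phi> x + t * \<phi> y - \<sigma> / 2 * (t * (1 - t) * (norm (\<gamma> x - \<gamma> y))\<^sup>2)"
    if t: "0 \<le> t" "t \<le> 1" for t x y
  proof -
    define u v where "u = (1 - t) *\<^sub>R x + t *\<^sub>R y" and "v = (1 - t) *\<^sub>R \<gamma> x + t *\<^sub>R \<gamma> y"
    have v: "(norm v)\<^sup>2 = (1 - t) * (norm (\<gamma> x))\<^sup>2 + t * (norm (\<gamma> y))\<^sup>2 - t * (1 - t) * (norm (\<gamma> x - \<gamma> y))\<^sup>2"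
      unfolding v_def power2_norm_eq_inner
      by (simp add: inner_add_left inner_add_right inner_diff_left inner_diff_right inner_commute algebra_simps)
    have "f u v + \<kappa> / 2 * (norm u)\<^sup>2 - \<sigma> / 2 * (norm v)\<^sup>2
        \<le> (1 - t) * (\<phi> x - \<sigma> / 2 * (norm (\<gamma> x))\<^sup>2) + t * (\<phi> y - \<sigma> / 2 * (norm (\<gamma> y))\<^sup>2)"
      using convex_onD[OF conv, of t "(x, \<gamma> x)" "(y, \<gamma> y)"] t by (simp add: u_def v_def \<phi>_def)
    then have "f u v + \<kappa> / 2 * (norm u)\<^sup>2
        \<le> (1 - t) * \<phi> x + t * \<phi> y - \<sigma> / 2 * (t * (1 - t) * (norm (\<gamma> x - \<gamma> y))\<^sup>2)"
    proof -
      have "(1 - t) * (a - s * b) + t * (c - s * d) + s * ((1 - t) * b + t * d - e)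
          = (1 - t) * a + t * c - s * e" for a b c d e s
        by (simp add: algebra_simps)
      from this[of "\<phi> x" "\<sigma> / 2" "(norm (\<gamma> x))\<^sup>2" "\<phi> y" "(norm (\<gamma> y))\<^sup>2"] show ?thesis
        using \<open>f u v + _ - _ \<le> _\<close> unfolding v by (smt (verit, best))
    qed
    then show ?thesis
      using \<phi>_le[of u v] by (simp add: u_def)
  qed
  have conv\<phi>: "convex_on UNIV \<phi>"
  proof (rule convex_onI)
    fix t x y assume t: "0 < t" "t < (1::real)"
    have "0 \<le> \<sigma> / 2 * (t * (1 - t) * (norm (\<gamma> x - \<gamma> y))\<^sup>2)"
      using t sigma by simp
    then show "\<phi> ((1 - t) *\<^sub>R x + t *\<^sub>R y) \<le> (1 - t) * \<phi> x + t * \<phi> y"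
      using \<phi>_strong[of t x y] t by linarith
  qed simp
  have mono: "\<sigma> / 2 * (norm (\<gamma> x - \<gamma> y))\<^sup>2 \<le> (p - q) \<bullet> (x - y)"
    if "subgradient \<phi> x p" "subgradient \<phi> y q" for x y p q
  proof -
    \<comment> \<open>The subgradient inequalities at \<open>x\<close> and at \<open>y\<close> are
      both evaluated at the midpoint; their sum is compared with \<open>\<phi>_strong\<close> for
      \<open>t = 1 / 2\<close>, whose form dictates the spelling of \<open>m\<close>.\<close>
    define m where "m = (1 - 1 / 2) *\<^sub>R x + (1 / 2) *\<^sub>R y"
    have m: "m - x = - ((1 / 2) *\<^sub>R (x - y))" "m - y = (1 / 2) *\<^sub>R (x - y)"
      by (simp_all add: m_def algebra_simps flip: scaleR_add_left)
    have "\<phi> m \<le> (\<phi> x + \<phi> y) / 2 - (\<sigma> / 2 * (norm (\<gamma> x - \<gamma> y))\<^sup>2) / 4"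
      using \<phi>_strong[of "1 / 2" x y] by (simp add: m_def field_simps)
    moreover have "\<phi> x - (p \<bullet> (x - y)) / 2 \<le> \<phi> m"
      using subgradientD[OF that(1), of m] unfolding m by simp
    moreover have "\<phi> y + (q \<bullet> (x - y)) / 2 \<le> \<phi> m"
      using subgradientD[OF that(2), of m] unfolding m by simp
    moreover have "s \<le> a - b" if "m \<le> (k + l) / 2 - s / 4" "k - a / 2 \<le> m" "l + b / 2 \<le> m"
      for a b k l m s :: real
      using that by (simp add: field_simps)
    ultimately show ?thesis
      unfolding inner_diff_left by blast
  qed
  show ?thesis
    using conv\<phi> _ mono by (rule AE_differentiable_if_subgradient_strongly_monotone) (use sigma in simp)
qed

end
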